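(* Let $\mathbb{F}$ be a field, let $V$ be a vector space over $\mathbb{F}$ with countable dimension, and let $u$ be a locally finite automorphism of $V$. Then $u$ is the product of two involutions in $\mathrm{GL}(V)$ if and only if $u$ is similar to its inverse $u^{-1}$.
   Context: "Countable" includes finite. An endomorphism $u$ of $V$ is locally finite if for every $x\in V$ the sequence $(u^k(x))_{k\ge 0}$ is linearly dependent over $\mathbb{F}$. $\mathrm{GL}(V)$ is the group of invertible endomorphisms of $V$. An involution is an endomorphism $a$ with $a^2=\mathrm{id}_V$ (so $\pm\mathrm{id}_V$ are allowed). Two endomorphisms $u,v$ of $V$ are similar if $v=\varphi\circ u\circ\varphi^{-1}$ for some $\varphi\in \mathrm{GL}(V)$. *)

theory Defs
  imports Complex_Main "HOL-Library.Countable_Set"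
begin

text \<open>Throughout, \<open>scale\<close> is the scalar multiplication of a vector space (locale
  \<open>vector_space\<close>) whose set of vectors is the whole type \<open>'v\<close>.\<close>

text \<open>The constant \<open>countable\<close> includes the finite case.\<close>

definition countable_dimension :: "('f::field \<Rightarrow> 'v::ab_group_add \<Rightarrow> 'v) \<Rightarrow> bool"
  where "countable_dimension scale \<longleftrightarrow>
    (\<exists>B. \<not> module.dependent scale B \<and> module.span scale B = UNIV \<and> countable B)"

definition endomorphism :: "('f::field \<Rightarrow> 'v::ab_group_add \<Rightarrow> 'v) \<Rightarrow> ('v \<Rightarrow> 'v) \<Rightarrow> bool"
  where "endomorphism scale u \<longleftrightarrow> Vector_Spaces.linear scale scale u"

definition GL :: "('f::field \<Rightarrow> 'v::ab_group_add \<Rightarrow> 'v) \<Rightarrow> ('v \<Rightarrow> 'v) set"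
  where "GL scale = {u. endomorphism scale u \<and> bij u}"

text \<open>Linear dependence of a family, as opposed to that of its range (the constant
  \<open>module.dependent\<close>): a family with a repeated entry is dependent.\<close>

definition dependent_family ::
    "('f::field \<Rightarrow> 'v::ab_group_add \<Rightarrow> 'v) \<Rightarrow> ('i \<Rightarrow> 'v) \<Rightarrow> bool"
  where "dependent_family scale x \<longleftrightarrow>
    (\<exists>I c. finite I \<and> (\<exists>i\<in>I. c i \<noteq> 0) \<and> (\<Sum>i\<in>I. scale (c i) (x i)) = 0)"

definition locally_finite :: "('f::field \<Rightarrow> 'v::ab_group_add \<Rightarrow> 'v) \<Rightarrow> ('v \<Rightarrow> 'v) \<Rightarrow> bool"
  where "locally_finite scale u \<longleftrightarrow> (\<forall>x. dependent_family scale (\<lambda>k::nat. (u ^^ k) x))"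

definition involution :: "('f::field \<Rightarrow> 'v::ab_group_add \<Rightarrow> 'v) \<Rightarrow> ('v \<Rightarrow> 'v) \<Rightarrow> bool"
  where "involution scale a \<longleftrightarrow> endomorphism scale a \<and> a \<circ> a = id"

definition similar ::
    "('f::field \<Rightarrow> 'v::ab_group_add \<Rightarrow> 'v) \<Rightarrow> ('v \<Rightarrow> 'v) \<Rightarrow> ('v \<Rightarrow> 'v) \<Rightarrow> bool"
  where "similar scale u v \<longleftrightarrow> (\<exists>\<phi>\<in>GL scale. v = \<phi> \<circ> u \<circ> inv \<phi>)"

end

theory Submission
  imports Defs "HOL-Computational_Algebra.Polynomial" "HOL-Library.Product_Plus"
begin

text \<open>
  The automorphism \<open>u = a \<circ> b\<close> is a product of two involutions if and only if some involution \<open>\<sigma>\<close>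
  satisfies \<open>\<sigma> \<circ> u = u\<^sup>-\<^sup>1 \<circ> \<sigma>\<close>. To find \<open>\<sigma>\<close>, regard \<open>V\<close> as a torsion module over the polynomials and
  split it into its \<open>p\<close>-components. If \<open>p\<close> differs from its reciprocal polynomial, then a similarity
  from \<open>u\<close> to its inverse and the inverse of that similarity exchange the components of \<open>p\<close> and of its
  reciprocal. If \<open>p\<close> is its own reciprocal, the component has, being countably generated, a tree basis
  \<open>X\<close>: a generating set such that \<open>p X \<subseteq> X \<union> {0}\<close> and all relations follow from those between \<open>x\<close> and
  \<open>p x\<close>. Mapping each \<open>x \<in> X\<close> to \<open>\<plusminus>u\<^sup>k x\<close> for a suitable \<open>k\<close> then defines \<open>\<sigma>\<close>.

  The tree basis is the union of an increasing sequence of finite sets closed under \<open>p\<close> in which the height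
  of a combination with coefficients prime to \<open>p\<close> is the least of the heights of its terms. As in
  Ulm's theorem, any element can be absorbed into the span of a larger such set.
\<close>

section \<open>Tree bases of modules\<close>

text \<open>Coefficients are treated from the largest exponent downwards. A term whose coefficient
  is divisible by \<open>p\<close> is moved from \<open>x\<close> to \<open>p *s x\<close>, which
  has a smaller exponent; digits already settled are not disturbed, and the process ends at exponent
  0.\<close>

lemma (in module) digit_expansion:
  assumes closed: "\<And>x. x \<in> X \<Longrightarrow> p *s x \<in> insert 0 X"
    and tors: "\<And>x. x \<in> X \<Longrightarrow> \<exists>n. p ^ n *s x = 0"
    and a: "a \<in> span X"
  shows "\<exists>Y r. finite Y \<and> Y \<subseteq> X \<and> (\<forall>y\<in>Y. \<not> p dvd r y) \<and> a = (\<Sum>y\<in>Y. r y *s y)"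
proof -
  define L where "L n = {x \<in> X. p ^ n *s x = 0}" for n
  have mono: "L n \<subseteq> L (Suc n)" for n
    by (auto simp: L_def simp flip: scale_scale)
  have expand: "\<exists>Y r. finite Y \<and> Y \<subseteq> L n \<and> (\<forall>y\<in>Y. \<not> p dvd r y) \<and> a = (\<Sum>y\<in>Y. r y *s y)"
    if "a \<in> span (L n)" for a n
    using that
  proof (induction n arbitrary: a)
    case 0
    have "L 0 \<subseteq> {0}" by (auto simp: L_def)
    then have "a = 0" using 0 span_minimal[OF _ subspace_single_0, of "L 0"] by auto
    then show ?case by (intro exI[of _ "{}"]) auto
  next
    case (Suc n)
    obtain t r where t: "finite t" "t \<subseteq> L (Suc n)" "a = (\<Sum>x\<in>t. r x *s x)"
      using Suc.prems by (auto simp: span_explicit)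
    \<comment> \<open>These digits are final: the remainder lies in \<open>span (L n)\<close>, and
      \<open>Y1\<close> avoids \<open>L n\<close>.\<close>
    define Y1 where "Y1 = {x \<in> t. \<not> p dvd r x \<and> x \<notin> L n}"
    have fin: "finite Y1" and sub: "Y1 \<subseteq> t" using t by (auto simp: Y1_def)
    have a: "a = (\<Sum>x\<in>t - Y1. r x *s x) + (\<Sum>x\<in>Y1. r x *s x)"
      unfolding t(3) by (rule sum.subset_diff[OF sub t(1)])
    have "r x *s x \<in> span (L n)" if "x \<in> t - Y1" for x
    proof (cases "x \<in> L n")
      case True then show ?thesis by (intro span_scale span_base)
    next
      case False
      then have "p dvd r x" using that by (auto simp: Y1_def)
      then obtain q where q: "r x = q * p" by (metis dvd_def mult.commute)
      have x: "x \<in> X" "p ^ Suc n *s x = 0" using that t(2) by (auto simp: L_def)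
      have "p ^ n *s p *s x = 0" using x(2) by (simp add: mult.commute)
      then have "p *s x \<in> insert 0 (L n)" using closed[OF x(1)] by (auto simp: L_def)
      then have "p *s x \<in> span (L n)" using span_base span_zero by auto
      then have "q *s p *s x \<in> span (L n)" by (rule span_scale)
      then show ?thesis by (simp add: q)
    qed
    then have "(\<Sum>x\<in>t - Y1. r x *s x) \<in> span (L n)" by (rule span_sum)
    from Suc.IH[OF this] obtain Y2 r2 where Y2: "finite Y2" "Y2 \<subseteq> L n" "\<forall>y\<in>Y2. \<not> p dvd r2 y"
       "(\<Sum>x\<in>t - Y1. r x *s x) = (\<Sum>y\<in>Y2. r2 y *s y)" by auto
    define r3 where "r3 y = (if y \<in> Y2 then r2 y else r y)" for y
    have disj: "Y1 \<inter> Y2 = {}" using Y2(2) by (auto simp: Y1_def)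
    have "a = (\<Sum>y\<in>Y2. r3 y *s y) + (\<Sum>y\<in>Y1. r3 y *s y)"
      unfolding a Y2(4) using disj by (intro arg_cong2[of _ _ _ _ "(+)"] sum.cong) (auto simp: r3_def)
    also have "\<dots> = (\<Sum>y\<in>Y1 \<union> Y2. r3 y *s y)"
      by (subst sum.union_disjoint[OF fin Y2(1) disj]) (rule add.commute)
    finally have "a = (\<Sum>y\<in>Y1 \<union> Y2. r3 y *s y)" .
    moreover have "\<forall>y\<in>Y1 \<union> Y2. \<not> p dvd r3 y" using Y2(3) by (auto simp: r3_def Y1_def)
    moreover have "Y1 \<union> Y2 \<subseteq> L (Suc n)" using t(2) sub Y2(2) mono by blast
    ultimately show ?case using fin Y2(1) by (intro exI[of _ "Y1 \<union> Y2"] exI[of _ r3]) auto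
  qed
  obtain t r where t: "finite t" "t \<subseteq> X" "a = (\<Sum>x\<in>t. r x *s x)"
    using a by (auto simp: span_explicit)
  obtain N where N: "\<And>x. x \<in> X \<Longrightarrow> p ^ N x *s x = 0" using tors by metis
  define n where "n = Max (insert 0 (N ` t))"
  have "t \<subseteq> L n"
  proof
    fix x assume x: "x \<in> t"
    then have "N x \<le> n" using t(1) by (simp add: n_def)
    then have "p ^ n = p ^ (n - N x) * p ^ N x" by (simp flip: power_add)
    then show "x \<in> L n" using x t(2) N by (auto simp: L_def simp flip: scale_scale)
  qed
  then have "a \<in> span (L n)" unfolding t(3) by (intro span_sum span_scale) (auto intro: span_base)
  from expand[OF this] show ?thesis unfolding L_def by fast
qed

text \<open>The last clause encodes that all relations follow from those between \<open>x\<close>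
  and \<open>p *s x\<close>: by \<open>digit_expansion\<close> these bring any relation into a form
  with coefficients prime to \<open>p\<close>, and such a relation must be empty.\<close>

definition (in module) tree_basis :: "'a \<Rightarrow> 'b set \<Rightarrow> bool" where
  "tree_basis p X \<longleftrightarrow> (\<forall>x\<in>X. p *s x \<in> insert 0 X) \<and> (\<forall>x\<in>X. \<exists>n. p ^ n *s x = 0) \<and>
     (\<forall>Y r. finite Y \<longrightarrow> Y \<subseteq> X \<longrightarrow> (\<forall>y\<in>Y. \<not> p dvd r y) \<longrightarrow> (\<Sum>y\<in>Y. r y *s y) = 0 \<longrightarrow> Y = {})"

lemma module_prod:
  assumes "module s1" "module s2"
  shows "module (\<lambda>r (a, b). (s1 r a, s2 r b))"
proof -
  interpret m1: module s1 by fact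
  interpret m2: module s2 by fact
  show ?thesis
    by unfold_locales (auto simp: m1.scale_right_distrib m2.scale_right_distrib
      m1.scale_left_distrib m2.scale_left_distrib)
qed

text \<open>The homomorphism is found as its graph, a submodule of the product: a digit expansion in the
  graph whose first component vanishes is empty.\<close>

lemma tree_basis_extend:
  fixes s1 :: "'r::comm_ring_1 \<Rightarrow> 'a::ab_group_add \<Rightarrow> 'a" and s2 :: "'r \<Rightarrow> 'b::ab_group_add \<Rightarrow> 'b"
  assumes "module s1" "module s2" and X: "module.tree_basis s1 p X"
    and g: "\<And>x. x \<in> X \<Longrightarrow> s2 p (g x) = g (s1 p x)" and g0: "g 0 = 0"
  obtains f where "\<And>x. x \<in> X \<Longrightarrow> f x = g x"
    and "\<And>a b. a \<in> module.span s1 X \<Longrightarrow> b \<in> module.span s1 X \<Longrightarrow> f (a + b) = f a + f b"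
    and "\<And>r a. a \<in> module.span s1 X \<Longrightarrow> f (s1 r a) = s2 r (f a)"
proof -
  interpret m1: module s1 by fact
  interpret m2: module s2 by fact
  define s where "s = (\<lambda>r (a, b). (s1 r a, s2 r b))"
  interpret m: module s unfolding s_def by (rule module_prod) fact+
  define G where "G = (\<lambda>x. (x, g x)) ` X"
  note X = X[unfolded m1.tree_basis_def]
  have closed: "s p z \<in> insert 0 G" if "z \<in> G" for z
    using that X g g0 by (force simp: G_def s_def zero_prod_def)
  have tors: "\<exists>n. s (p ^ n) z = 0" if z: "z \<in> G" for z
  proof -
    obtain x where x: "x \<in> X" "z = (x, g x)" using z by (auto simp: G_def)
    \<comment> \<open>Along the orbit of \<open>x\<close> under \<open>p\<close> the map
      \<open>g\<close> follows the tree, so \<open>(x, g x)\<close> is killed as soon as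
      \<open>x\<close> is, because \<open>g 0 = 0\<close>.\<close>
    have "s1 (p ^ n) x \<in> insert 0 X \<and> s2 (p ^ n) (g x) = g (s1 (p ^ n) x)" for n
    proof (induction n)
      case (Suc n)
      show ?case using Suc X g g0 by (auto simp flip: m1.scale_scale m2.scale_scale)
    qed (use x in auto)
    moreover obtain n where "s1 (p ^ n) x = 0" using X x by blast
    ultimately show ?thesis using g0 by (intro exI[of _ n]) (auto simp: s_def x zero_prod_def)
  qed
  have single: "b = 0" if ab: "(0, b) \<in> m.span G" for b
  proof -
    obtain Y r where Y: "finite Y" "Y \<subseteq> G" "\<forall>y\<in>Y. \<not> p dvd r y" "(0, b) = (\<Sum>y\<in>Y. s (r y) y)"
      using m.digit_expansion[OF closed tors ab] by auto
    obtain Z where Z: "Z \<subseteq> X" "Y = (\<lambda>x. (x, g x)) ` Z"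
      using Y(2) unfolding G_def by (meson subset_imageE)
    have inj: "inj_on (\<lambda>x. (x, g x)) Z" by (auto intro: inj_onI)
    have "fst (\<Sum>y\<in>Y. s (r y) y) = (\<Sum>y\<in>Y. fst (s (r y) y))"
      by (induction Y rule: infinite_finite_induct) auto
    also have "\<dots> = (\<Sum>x\<in>Z. s1 (r (x, g x)) x)"
      unfolding Z(2) sum.reindex[OF inj] by (simp add: s_def)
    finally have "(\<Sum>x\<in>Z. s1 (r (x, g x)) x) = 0" using Y(4) by (metis fst_conv)
    moreover have "finite Z" using Y(1) Z(2) inj by (simp add: finite_image_iff)
    moreover have "\<forall>x\<in>Z. \<not> p dvd r (x, g x)" using Y(3) Z(2) by auto
    ultimately have "Z = {}"
      using X[THEN conjunct2, THEN conjunct2, rule_format, of Z "\<lambda>x. r (x, g x)"] Z(1) by simp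
    then show "b = 0" using Y(4) Z by (simp add: zero_prod_def)
  qed
  have uniq: "b = b'" if "(a, b) \<in> m.span G" "(a, b') \<in> m.span G" for a b b'
    using single[of "b - b'"] m.span_diff[OF that] by simp
  have ex: "\<exists>b. (a, b) \<in> m.span G" if "a \<in> m1.span X" for a
    using that
  proof (induction rule: m1.span_induct_alt)
    case base
    then show ?case using m.span_zero by (auto simp: zero_prod_def)
  next
    case (step c x y)
    then obtain b where "(y, b) \<in> m.span G" by auto
    moreover have "s c (x, g x) \<in> m.span G"
      using step by (intro m.span_scale m.span_base) (auto simp: G_def)
    ultimately have "s c (x, g x) + (y, b) \<in> m.span G" by (intro m.span_add)
    then show ?case by (auto simp: s_def)
  qed
  define f where "f a = (THE b. (a, b) \<in> m.span G)" for a
  have f: "f a = b" if "(a, b) \<in> m.span G" for a b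
    unfolding f_def by (rule the_equality) (use that uniq in auto)
  have fG: "(a, f a) \<in> m.span G" if "a \<in> m1.span X" for a
    using ex[OF that] f by auto
  show thesis
  proof
    show "f x = g x" if "x \<in> X" for x
      using that by (intro f m.span_base) (auto simp: G_def)
    show "f (a + b) = f a + f b" if "a \<in> m1.span X" "b \<in> m1.span X" for a b
      using m.span_add[OF fG[OF that(1)] fG[OF that(2)]] by (intro f) simp
    show "f (s1 r a) = s2 r (f a)" if "a \<in> m1.span X" for r a
      using m.span_scale[OF fG[OF that], of r] by (intro f) (simp add: s_def)
  qed
qed

section \<open>Heights in primary modules\<close>

text \<open>The errors \<open>s' * r - 1\<close> and \<open>s * r - 1\<close> multiply to an error
  divisible by one more power of \<open>p\<close>, and their product is again 1 minus a multiple of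
  \<open>r\<close>.\<close>

lemma bezout_power:
  fixes p r :: "'a::comm_ring_1"
  assumes "s * r = 1 + q * p"
  shows "\<exists>s k. s * r = 1 + k * p ^ n"
proof (induction n)
  case 0
  show ?case by (intro exI[of _ 0] exI[of _ "- 1"]) simp
next
  case (Suc n)
  then obtain s' k where "s' * r = 1 + k * p ^ n" by blast
  then have "(s' * r - 1) * (s * r - 1) = k * p ^ n * (q * p)" using assms by simp
  then have "(s + s' - s * s' * r) * r = 1 + - (k * q) * p ^ Suc n"
    by (simp add: algebra_simps)
  then show ?case by blast
qed

text \<open>An abstraction of the component of one irreducible polynomial: \<open>maximal\<close>
  says that the ring modulo \<open>p\<close> is a field or zero, and the carrier is a submodule
  because the component is only a part of \<open>V\<close>.\<close>

locale primary_module = module scale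
  for scale :: "'a::comm_ring_1 \<Rightarrow> 'b::ab_group_add \<Rightarrow> 'b" (infixr "*s" 75) +
  fixes p :: 'a and M :: "'b set"
  assumes subspace_M: "subspace M"
    and maximal: "\<not> p dvd r \<Longrightarrow> \<exists>s q. s * r = 1 + q * p"
    and torsion: "x \<in> M \<Longrightarrow> \<exists>n. p ^ n *s x = 0"
begin

text \<open>The same \<open>s\<close> serves all elements killed by \<open>p ^ n\<close>;
  \<open>nice_extend_proper\<close> inverts a coefficient on two elements at once.\<close>

lemma inverse_modulo_power:
  assumes "\<not> p dvd r"
  shows "\<exists>s. \<forall>v. p ^ n *s v = 0 \<longrightarrow> s *s r *s v = v"
proof -
  obtain s q where "s * r = 1 + q * p" using maximal[OF assms] by auto
  then obtain s k where sk: "s * r = 1 + k * p ^ n" using bezout_power by blast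
  have "s *s r *s v = v" if "p ^ n *s v = 0" for v
  proof -
    have "s *s r *s v = v + k *s p ^ n *s v" by (simp add: sk scale_left_distrib)
    then show ?thesis using that by simp
  qed
  then show ?thesis by blast
qed

lemma inverse_on:
  assumes "\<not> p dvd r" "x \<in> M"
  obtains s where "s *s r *s x = x"
  using inverse_modulo_power[OF assms(1)] torsion[OF assms(2)] by metis

end

text \<open>\<open>H x\<close> plays the role of the set of elements whose height is at least that of \<open>x\<close>.\<close>

locale filtered_module = primary_module scale p M
  for scale :: "'a::comm_ring_1 \<Rightarrow> 'b::ab_group_add \<Rightarrow> 'b" (infixr "*s" 75) and p M +
  fixes H :: "'b \<Rightarrow> 'b set"
  assumes subspace_H: "x \<in> M \<Longrightarrow> subspace (H x)"
    and H_sub: "x \<in> M \<Longrightarrow> H x \<subseteq> M"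
    and H_self: "x \<in> M \<Longrightarrow> x \<in> H x"
    and H_least: "x \<in> M \<Longrightarrow> y \<in> H x \<Longrightarrow> H y \<subseteq> H x"
    and H_linear: "x \<in> M \<Longrightarrow> y \<in> M \<Longrightarrow> H x \<subseteq> H y \<or> H y \<subseteq> H x"
    and H_mult: "x \<in> M \<Longrightarrow> x \<noteq> 0 \<Longrightarrow> H (p *s x) \<subset> H x"
    and H_div: "z \<in> M \<Longrightarrow> w \<in> M \<Longrightarrow> H z \<subset> H w \<Longrightarrow> \<exists>y\<in>H w. p *s y = z"

text \<open>The transfinite sequence of submodules \<open>p ^ \<alpha> M\<close>, encoded without
  ordinals: images are the successor stages and intersections the limit stages.\<close>

inductive_set (in primary_module) tower :: "'b set set" where
  top: "M \<in> tower"
| mult: "N \<in> tower \<Longrightarrow> (*s) p ` N \<in> tower"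
| Inter: "S \<noteq> {} \<Longrightarrow> (\<And>N. N \<in> S \<Longrightarrow> N \<in> tower) \<Longrightarrow> \<Inter>S \<in> tower"

context primary_module
begin

lemma tower_subspace: "N \<in> tower \<Longrightarrow> subspace N"
proof (induction rule: tower.induct)
  case (mult N)
  then have N: "subspace N" by simp
  show ?case
  proof (rule subspaceI)
    show "0 \<in> (*s) p ` N" using subspace_0[OF N] by (metis image_eqI scale_zero_right)
    show "a + b \<in> (*s) p ` N" if "a \<in> (*s) p ` N" "b \<in> (*s) p ` N" for a b
      using that subspace_add[OF N] by (auto simp flip: scale_right_distrib)
    show "r *s a \<in> (*s) p ` N" if "a \<in> (*s) p ` N" for r a
    proof -
      from that obtain b where "b \<in> N" "a = p *s b" by blast
      then show ?thesis using subspace_scale[OF N] by (metis imageI scale_left_commute)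
    qed
  qed
qed (auto intro: subspace_M subspace_Inter)

lemma tower_mult_sub: "N \<in> tower \<Longrightarrow> (*s) p ` N \<subseteq> N"
  using subspace_scale[OF tower_subspace] by auto

lemma tower_sub: "N \<in> tower \<Longrightarrow> N \<subseteq> M"
proof (induction rule: tower.induct)
  case (mult N)
  then show ?case using tower_mult_sub by blast
qed auto

text \<open>Zermelo's argument for chains. Besides comparability it shows that no stage lies
  strictly between \<open>N\<close> and its image, which is what makes the division by
  \<open>p\<close> in \<open>H_div\<close> possible.\<close>

lemma tower_step:
  assumes "N \<in> tower" and K: "K \<in> tower"
  shows "N \<subseteq> K \<or> K \<subseteq> (*s) p ` N"
proof -
  \<comment> \<open>By \<open>ext\<close>, a stage strictly above \<open>N\<close> still contains
    \<open>N\<close> after multiplication by \<open>p\<close>. For such \<open>N\<close>, induction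
    on \<open>K\<close> gives the alternative; a second induction shows that every stage
    \<open>N\<close> is of this kind.\<close>
  have dich: "N \<subseteq> K \<or> K \<subseteq> (*s) p ` N"
    if ext: "\<forall>K\<in>tower. N \<subset> K \<longrightarrow> N \<subseteq> (*s) p ` K" and N: "N \<in> tower" and K: "K \<in> tower" for N K
    using K
  proof (induction rule: tower.induct)
    case top
    then show ?case using tower_sub[OF N] by simp
  next
    case (mult K)
    show ?case
    proof (cases "N \<subseteq> K")
      case True
      then show ?thesis using ext mult.hyps by blast
    next
      case False
      then have "K \<subseteq> (*s) p ` N" using mult.IH by simp
      then show ?thesis using tower_mult_sub[OF mult.hyps] by blast
    qed
  next
    case (Inter S)
    then show ?case by (metis Inf_lower2 le_Inf_iff)
  qed
  have ext: "\<forall>K\<in>tower. N \<subset> K \<longrightarrow> N \<subseteq> (*s) p ` K" if "N \<in> tower" for N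
    using that
  proof (induction rule: tower.induct)
    case top
    then show ?case using tower_sub by auto
  next
    case (mult N)
    show ?case
    proof (intro ballI impI)
      fix K assume K: "K \<in> tower" "(*s) p ` N \<subset> K"
      then have "N \<subseteq> K" using dich[OF mult.IH mult.hyps] by blast
      then show "(*s) p ` N \<subseteq> (*s) p ` K" by blast
    qed
  next
    case (Inter S)
    show ?case
    proof (intro ballI impI)
      fix K assume K: "K \<in> tower" "\<Inter>S \<subset> K"
      then obtain N where N: "N \<in> S" "\<not> K \<subseteq> N" by blast
      have NT: "N \<in> tower" and ext: "\<forall>K\<in>tower. N \<subset> K \<longrightarrow> N \<subseteq> (*s) p ` K"
        using Inter N(1) by auto
      have "N \<subseteq> K" using dich[OF ext NT K(1)] tower_mult_sub[OF NT] N(2) by auto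
      then have "N \<subseteq> (*s) p ` K" using ext K(1) N(2) by auto
      then show "\<Inter>S \<subseteq> (*s) p ` K" using N by blast
    qed
  qed
  show ?thesis by (rule dich[OF ext[OF assms(1)] assms])
qed

lemma tower_linear: "N \<in> tower \<Longrightarrow> K \<in> tower \<Longrightarrow> N \<subseteq> K \<or> K \<subseteq> N"
  using tower_step[of N K] tower_mult_sub[of N] by blast

lemma tower_fixed:
  assumes "K \<in> tower" and N: "N \<in> tower" "(*s) p ` N = N"
  shows "N \<subseteq> K"
  using assms(1)
proof (induction rule: tower.induct)
  case (mult K)
  then have "(*s) p ` N \<subseteq> (*s) p ` K" by blast
  then show ?case using N by simp
qed (use tower_sub N in auto)

text \<open>Off the intersection \<open>D\<close> of the tower, \<open>H\<close> compares the positions in the tower; on the divisible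
  submodule \<open>D\<close>, where these agree, it compares the annihilators instead.\<close>

lemma filtration_exists: "\<exists>H. filtered_module scale p M H"
proof -
  define T where "T x = \<Inter>{N \<in> tower. x \<in> N}" for x
  define D where "D = \<Inter>tower"
  define H where "H x = (if x \<in> D then {y \<in> D. \<forall>n. p ^ n *s x = 0 \<longrightarrow> p ^ n *s y = 0} else T x)" for x
  have D: "D \<in> tower" unfolding D_def using tower.top by (intro tower.Inter) auto
  \<comment> \<open>\<open>D\<close> is a stage, hence so is its image, which therefore contains the
    smallest stage \<open>D\<close>: thus \<open>D\<close> is divisible.\<close>
  have Dp: "(*s) p ` D = D"
    using tower_mult_sub[OF D] tower.mult[OF D] by (auto simp: D_def)
  have T: "T x \<in> tower" "x \<in> T x" if "x \<in> M" for x
    unfolding T_def using that tower.top by (auto intro!: tower.Inter)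
  have T_least: "T x \<subseteq> N" if "x \<in> N" "N \<in> tower" for x N
    using that by (auto simp: T_def)
  have D_least: "D \<subseteq> N" if "N \<in> tower" for N
    using that by (auto simp: D_def)
  have DM: "D \<subseteq> M" using tower_sub[OF D] .
  have subD: "subspace D" using tower_subspace[OF D] .
  have kill: "p ^ m *s x = 0" if "p ^ n *s x = 0" "n \<le> m" for x n m
  proof -
    have "p ^ m = p ^ (m - n) * p ^ n" using that(2) by (simp flip: power_add)
    then show ?thesis using that(1) by (simp flip: scale_scale)
  qed
  define e where "e x = (LEAST n. p ^ n *s x = 0)" for x
  have e: "p ^ n *s x = 0 \<longleftrightarrow> e x \<le> n" if x: "x \<in> M" for x n
  proof
    show "e x \<le> n" if "p ^ n *s x = 0" unfolding e_def using that by (rule Least_le)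
    obtain m where "p ^ m *s x = 0" using torsion[OF x] by blast
    then have "p ^ e x *s x = 0" unfolding e_def by (rule LeastI)
    then show "p ^ n *s x = 0" if "e x \<le> n" using kill that by blast
  qed
  \<comment> \<open>On \<open>D\<close> a smaller exponent counts as a greater height, so that
    multiplication by \<open>p\<close> still moves strictly down.\<close>
  have HD: "H x = {y \<in> D. e y \<le> e x}" if x: "x \<in> D" for x
  proof -
    have "(\<forall>n. p ^ n *s x = 0 \<longrightarrow> p ^ n *s y = 0) \<longleftrightarrow> e y \<le> e x" if y: "y \<in> D" for y
      unfolding e[OF subsetD[OF DM x]] e[OF subsetD[OF DM y]] by (auto intro: order.trans)
    then show ?thesis using x by (auto simp: H_def)
  qed
  have HT: "H x = T x" if "x \<notin> D" for x
    using that by (simp add: H_def)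
  have HDD: "H x \<subset> T y" if "x \<in> D" "y \<in> M" "y \<notin> D" for x y
    using that HD[of x] D_least[OF T(1)[of y]] T(2)[of y] by auto
  have ep: "e x = Suc (e (p *s x))" if x: "x \<in> M" "x \<noteq> 0" for x
  proof -
    have px: "p *s x \<in> M" using x subspace_M by (simp add: subspace_scale)
    have eq: "e x \<le> Suc n \<longleftrightarrow> e (p *s x) \<le> n" for n
      unfolding e[OF px, symmetric] e[OF x(1), symmetric] by (simp add: mult.commute)
    have "e x \<noteq> 0" using e[OF x(1), of 0] x(2) by simp
    then obtain m where "e x = Suc m" using not0_implies_Suc by blast
    then show ?thesis using eq[of m] eq[of "e (p *s x)"] by simp
  qed
  have lc: "p ^ n *s c *s y = c *s p ^ n *s y" for n c y by (rule scale_left_commute)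
  have "filtered_module scale p M H"
  proof
    fix x assume x: "x \<in> M"
    show "subspace (H x)"
    proof (cases "x \<in> D")
      case True
      then show ?thesis unfolding H_def using subD
        by (auto intro!: subspaceI simp: subspace_0 subspace_add subspace_scale scale_right_distrib
          lc simp del: scale_scale)
    qed (simp add: HT tower_subspace T x)
    show "H x \<subseteq> M" using DM tower_sub[OF T(1)[OF x]] by (auto simp: H_def)
    show "x \<in> H x" using T x by (auto simp: H_def)
  next
    fix x y assume x: "x \<in> M" and y: "y \<in> H x"
    show "H y \<subseteq> H x"
    proof (cases "x \<in> D")
      case True
      then show ?thesis using y by (auto simp: HD)
    next
      case False
      then have "T y \<subseteq> T x" using y T_least T(1)[OF x] by (simp add: HT)
      then show ?thesis using HDD[of y x] False x by (cases "y \<in> D") (auto simp: HT)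
    qed
  next
    fix x y assume "x \<in> M" "y \<in> M"
    then show "H x \<subseteq> H y \<or> H y \<subseteq> H x"
      using HDD[of x y] HDD[of y x] tower_linear[OF T(1) T(1), of x y]
      by (cases "x \<in> D"; cases "y \<in> D") (auto simp: HD HT)
  next
    fix x assume x: "x \<in> M" "x \<noteq> 0"
    show "H (p *s x) \<subset> H x"
    proof (cases "x \<in> D")
      case True
      then have "p *s x \<in> D" using Dp by blast
      then have "x \<in> H x" "x \<notin> H (p *s x)" "H (p *s x) \<subseteq> H x"
        using True ep[OF x] by (auto simp: HD)
      then show ?thesis by blast
    next
      case False
      show ?thesis
      proof (cases "p *s x \<in> D")
        case True
        then show ?thesis using HDD x False by (simp add: HT)
      next
        case pF: False
        \<comment> \<open>The image of \<open>T x\<close> is a stage containing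
          \<open>p *s x\<close>. If it were all of \<open>T x\<close>, then
          \<open>tower_fixed\<close> would put \<open>T x\<close>, and \<open>x\<close> with it,
          into \<open>D\<close>.\<close>
        have "T (p *s x) \<subseteq> (*s) p ` T x" using T[OF x(1)] by (intro T_least tower.mult) auto
        moreover have "(*s) p ` T x \<noteq> T x"
        proof
          assume "(*s) p ` T x = T x"
          then have "T x \<subseteq> D" using T(1)[OF x(1)] D by (intro tower_fixed)
          then show False using False T(2)[OF x(1)] by blast
        qed
        ultimately show ?thesis using tower_mult_sub[OF T(1)[OF x(1)]] by (auto simp: HT False pF)
      qed
    qed
  next
    fix z w assume z: "z \<in> M" and w: "w \<in> M" and lt: "H z \<subset> H w"
    show "\<exists>y\<in>H w. p *s y = z"
    proof (cases "w \<in> D")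
      case True
      then have "H w \<subseteq> D" by (auto simp: HD)
      then have zD: "z \<in> D" using lt T(2)[OF z] HT[of z] by blast
      \<comment> \<open>In \<open>D\<close> a strict inclusion means a smaller exponent. Dividing
        \<open>z\<close> by \<open>p\<close> inside \<open>D\<close> raises the exponent by exactly
        one, unless the quotient is 0, so the quotient stays in \<open>H w\<close>.\<close>
      have less: "e z < e w"
      proof (rule ccontr)
        assume "\<not> e z < e w"
        then have "H w \<subseteq> H z" using HD[OF zD] HD[OF True] by auto
        then show False using lt by blast
      qed
      have "z \<in> (*s) p ` D" using Dp zD by simp
      then obtain y where y: "y \<in> D" "p *s y = z" by auto
      have "e y \<le> e w"
      proof (cases "y = 0")
        case False
        then show ?thesis using ep[of y] y DM less by auto
      qed (use e[of 0 0] DM y in auto)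
      then show ?thesis using y True by (auto simp: HD)
    next
      case False
      have "z \<in> (*s) p ` T w"
      proof (cases "z \<in> D")
        case True
        then show ?thesis using Dp D_least[OF T(1)[OF w]] by blast
      next
        case zF: False
        then have "T z \<subset> T w" using lt False by (simp add: HT)
        then have "T z \<subseteq> (*s) p ` T w" using tower_step[OF T(1)[OF w] T(1)[OF z]] by blast
        then show ?thesis using T(2)[OF z] by blast
      qed
      then show ?thesis using False by (auto simp: HT)
    qed
  qed
  then show ?thesis by (intro exI[of _ H])
qed

end

section \<open>Construction of a tree basis\<close>

context filtered_module
begin

section \<open>Ultrametric rules for heights\<close>

lemma in_M: "x \<in> M \<Longrightarrow> y \<in> H x \<Longrightarrow> y \<in> M"
  using H_sub by blast

lemma zero_M: "0 \<in> M"
  using subspace_M by (rule subspace_0)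

lemma scale_M: "x \<in> M \<Longrightarrow> r *s x \<in> M"
  using subspace_M by (rule subspace_scale)

lemma add_M: "x \<in> M \<Longrightarrow> y \<in> M \<Longrightarrow> x + y \<in> M"
  using subspace_M by (rule subspace_add)

lemma zero_H: "x \<in> M \<Longrightarrow> 0 \<in> H x"
  using subspace_H by (rule subspace_0)

lemma H_subset_iff: "x \<in> M \<Longrightarrow> y \<in> M \<Longrightarrow> H y \<subseteq> H x \<longleftrightarrow> y \<in> H x"
  using H_self H_least by blast

lemma not_in_H: "x \<in> M \<Longrightarrow> y \<in> M \<Longrightarrow> y \<notin> H x \<longleftrightarrow> H x \<subset> H y"
  using H_subset_iff H_linear by blast

text \<open>For a nonzero \<open>y\<close> in \<open>H 0\<close> the element \<open>p *s y\<close>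
  would be strictly below 0, whereas 0 lies in every \<open>H x\<close> with \<open>x\<close> in
  \<open>M\<close>.\<close>

lemma H_zero: "H 0 = {0}"
proof -
  have "y = 0" if y: "y \<in> H 0" for y
  proof (rule ccontr)
    assume "y \<noteq> 0"
    moreover have yM: "y \<in> M" using y in_M zero_M by blast
    ultimately have "H (p *s y) \<subset> H 0" using H_mult H_least[OF zero_M y] by blast
    moreover have "H 0 \<subseteq> H (p *s y)" using yM by (intro H_least zero_H scale_M)
    ultimately show False by blast
  qed
  then show ?thesis using zero_H[OF zero_M] by blast
qed

text \<open>Being strictly below \<open>x\<close> means having strictly greater height.\<close>

definition lower :: "'b \<Rightarrow> 'b set" where
  "lower x = {y \<in> M. H y \<subset> H x}"

lemma lower_iff: "x \<in> M \<Longrightarrow> y \<in> lower x \<longleftrightarrow> y \<in> M \<and> x \<notin> H y"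
  unfolding lower_def using not_in_H[of y x] by blast

lemma subspace_lower:
  assumes "x \<in> M" "x \<noteq> 0"
  shows "subspace (lower x)"
proof (rule subspaceI)
  show "0 \<in> lower x" using assms zero_M by (simp add: lower_iff H_zero)
  show "a + b \<in> lower x" if a: "a \<in> lower x" and b: "b \<in> lower x" for a b
  proof -
    have ab: "a \<in> M" "b \<in> M" using a b by (auto simp: lower_def)
    have "x \<notin> H (a + b)"
    proof (cases "H a \<subseteq> H b")
      case True
      then have "a + b \<in> H b" using ab H_self by (intro subspace_add subspace_H) auto
      then show ?thesis using H_least ab b assms by (auto simp: lower_iff)
    next
      case False
      then have "H b \<subseteq> H a" using H_linear ab by blast
      then have "a + b \<in> H a" using ab H_self by (intro subspace_add subspace_H) auto
      then show ?thesis using H_least ab a assms by (auto simp: lower_iff)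
    qed
    then show ?thesis using ab add_M assms by (simp add: lower_iff)
  qed
  show "c *s a \<in> lower x" if "a \<in> lower x" for c a
  proof -
    have a: "a \<in> M" using that by (auto simp: lower_def)
    then have "c *s a \<in> H a" using H_self by (intro subspace_scale subspace_H)
    then show ?thesis using that a H_least[of a] scale_M assms by (auto simp: lower_iff)
  qed
qed

lemma lower_mult: "x \<in> M \<Longrightarrow> x \<noteq> 0 \<Longrightarrow> p *s x \<in> lower x"
  using H_mult scale_M by (auto simp: lower_def)

lemma lower_mono: "x \<in> M \<Longrightarrow> y \<in> H x \<Longrightarrow> lower y \<subseteq> lower x"
  using H_least[of x y] by (auto simp: lower_def)

lemma lower_sub_H: "x \<in> M \<Longrightarrow> lower x \<subseteq> H x"
  using H_self by (auto simp: lower_def)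

text \<open>Otherwise \<open>a + b\<close> would be strictly below \<open>a\<close>, and so would
  \<open>a\<close>, as a difference of two elements of the submodule \<open>lower a\<close>.\<close>

lemma H_add_lower:
  assumes "a \<in> M" "b \<in> lower a"
  shows "H (a + b) = H a"
proof (rule ccontr)
  assume neq: "H (a + b) \<noteq> H a"
  have b: "b \<in> M" "b \<in> H a" using assms lower_sub_H by (auto simp: lower_def)
  have a0: "a \<noteq> 0"
    using assms zero_H[OF b(1)] by (auto simp: lower_iff)
  have "a + b \<in> H a" using assms b H_self by (intro subspace_add subspace_H)
  then have "a + b \<in> lower a" using neq H_least assms add_M b by (auto simp: lower_def)
  then have "a + b - b \<in> lower a" using assms by (intro subspace_diff subspace_lower a0)
  then show False using assms by (simp add: lower_def)
qed

text \<open>If the heights differed, the smaller one would be the height of the sum by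
  \<open>H_add_lower\<close>, so the sum could not be strictly below \<open>y\<close>.\<close>

lemma H_add_cancel:
  assumes "y \<in> M" "a \<in> M" "y + a \<in> lower y"
  shows "H a = H y"
proof (rule ccontr)
  assume "H a \<noteq> H y"
  then consider "a \<in> lower y" | "y \<in> lower a" using H_linear assms by (auto simp: lower_def)
  then show False
  proof cases
    case 1
    then show False using H_add_lower assms by (simp add: lower_def)
  next
    case 2
    then show False using H_add_lower[of a y] assms by (auto simp: lower_def add.commute)
  qed
qed

text \<open>The last clause bounds the height of a combination from above by the heights of its
  terms; the bound from below holds because each \<open>H y\<close> is a submodule. As
  \<open>H 0 = {0}\<close>, the clause contains the independence demanded by
  \<open>tree_basis\<close>.\<close>

definition nice :: "'b set \<Rightarrow> bool" where
  "nice X \<longleftrightarrow> finite X \<and> X \<subseteq> M \<and> 0 \<notin> X \<and> (\<forall>x\<in>X. p *s x \<in> insert 0 X) \<and>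
     (\<forall>Y r. Y \<subseteq> X \<longrightarrow> (\<forall>y\<in>Y. \<not> p dvd r y) \<longrightarrow> (\<forall>y\<in>Y. y \<in> H (\<Sum>y\<in>Y. r y *s y)))"

lemma niceD:
  assumes "nice X"
  shows "finite X" "X \<subseteq> M" "0 \<notin> X" "\<And>x. x \<in> X \<Longrightarrow> p *s x \<in> insert 0 X"
    "\<And>Y r y. Y \<subseteq> X \<Longrightarrow> (\<And>y. y \<in> Y \<Longrightarrow> \<not> p dvd r y) \<Longrightarrow> y \<in> Y \<Longrightarrow> y \<in> H (\<Sum>y\<in>Y. r y *s y)"
  using assms by (auto simp: nice_def)

lemma nice_span: "nice X \<Longrightarrow> span X \<subseteq> M"
  using niceD(2) subspace_M by (intro span_minimal)

lemma nice_expansion: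
  assumes "nice X" "a \<in> span X"
  obtains Y r where "finite Y" "Y \<subseteq> X" "\<And>y. y \<in> Y \<Longrightarrow> \<not> p dvd r y" "a = (\<Sum>y\<in>Y. r y *s y)"
    "\<And>y. y \<in> Y \<Longrightarrow> y \<in> H a"
proof -
  have "\<exists>Y r. finite Y \<and> Y \<subseteq> X \<and> (\<forall>y\<in>Y. \<not> p dvd r y) \<and> a = (\<Sum>y\<in>Y. r y *s y)"
    using niceD(4)[OF assms(1)] torsion niceD(2)[OF assms(1)] assms(2) by (intro digit_expansion) auto
  then obtain Y r where Y: "finite Y" "Y \<subseteq> X" "\<And>y. y \<in> Y \<Longrightarrow> \<not> p dvd r y"
    "a = (\<Sum>y\<in>Y. r y *s y)" by auto
  moreover have "y \<in> H a" if "y \<in> Y" for y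
    unfolding Y(4) using niceD(5)[OF assms(1) Y(2,3) that] .
  ultimately show ?thesis using that by blast
qed

text \<open>In a digit expansion of \<open>a\<close>, a term \<open>y\<close> with largest
  \<open>H y\<close> has the height of \<open>a\<close>. Hence only finitely many heights occur in
  \<open>span X\<close>.\<close>

lemma nice_height:
  assumes X: "nice X" and a: "a \<in> span X" "a \<noteq> 0"
  shows "\<exists>x\<in>X. H x = H a"
proof -
  obtain Y r where Y: "finite Y" "Y \<subseteq> X" "a = (\<Sum>y\<in>Y. r y *s y)" "\<And>y. y \<in> Y \<Longrightarrow> y \<in> H a"
    using nice_expansion[OF X a(1)] by metis
  have YM: "Y \<subseteq> M" using Y niceD(2)[OF X] by blast
  have aM: "a \<in> M" using a nice_span[OF X] by blast
  have "Y \<noteq> {}" using Y a by auto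
  then obtain y where y: "y \<in> Y" "\<And>y'. y' \<in> Y \<Longrightarrow> H y \<subseteq> H y' \<Longrightarrow> H y = H y'"
    using finite_has_maximal[of "H ` Y"] Y(1) by auto
  have "y' \<in> H y" if "y' \<in> Y" for y'
    using y(2)[OF that] H_linear[of y y'] H_self[of y'] that y(1) YM by blast
  then have "a \<in> H y"
    unfolding Y(3) using YM y(1) by (intro subspace_sum subspace_scale subspace_H) auto
  then have "H a = H y"
    using H_least[of y a] H_least[OF aM Y(4)[OF y(1)]] subsetD[OF YM y(1)] by simp
  then show ?thesis using y(1) Y(2) by (metis subsetD)
qed

lemma not_dvd_1:
  assumes "x \<in> M" "x \<noteq> 0"
  shows "\<not> p dvd 1"
proof
  assume "p dvd 1"
  then obtain k where k: "1 = p * k" by (auto simp: dvd_def)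
  obtain n where n: "p ^ n *s x = 0" using torsion assms by blast
  have "k ^ n * p ^ n = 1" using k by (metis mult.commute power_mult_distrib power_one)
  then have "x = k ^ n *s p ^ n *s x" by simp
  then show False using n assms(2) by simp
qed

text \<open>Since \<open>p *s y\<close> is strictly below \<open>y\<close>, the terms with
  coefficient divisible by \<open>p\<close> are strictly below \<open>y0\<close> and can be removed;
  the last clause of \<open>nice\<close> applies to the others.\<close>

lemma nice_min:
  assumes X: "nice X" and Y: "Y \<subseteq> X" and y0: "y0 \<in> Y" "\<not> p dvd r y0" and le: "\<And>y. y \<in> Y \<Longrightarrow> y \<in> H y0"
  shows "y0 \<in> H (\<Sum>y\<in>Y. r y *s y)"
proof (rule ccontr)
  define Y1 where "Y1 = {y \<in> Y. \<not> p dvd r y}"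
  have fin: "finite Y" using Y niceD(1)[OF X] finite_subset by blast
  have YM: "Y \<subseteq> M" and Y0: "0 \<notin> Y" using Y niceD(2,3)[OF X] by blast+
  have y0M: "y0 \<in> M" "y0 \<noteq> 0" using y0 YM Y0 by auto
  note sub = subspace_lower[OF y0M]
  have "(\<Sum>y\<in>Y - Y1. r y *s y) \<in> lower y0"
  proof (rule subspace_sum[OF sub])
    fix y assume y: "y \<in> Y - Y1"
    then obtain q where q: "r y = q * p" by (auto simp: Y1_def dvd_def mult.commute)
    have yM: "y \<in> M" "y \<noteq> 0" using y YM Y0 by auto
    then have "p *s y \<in> lower y0" using lower_mult lower_mono[OF y0M(1) le] y by blast
    then show "r y *s y \<in> lower y0" using subspace_scale[OF sub] by (simp add: q flip: scale_scale)
  qed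
  moreover assume "y0 \<notin> H (\<Sum>y\<in>Y. r y *s y)"
  then have "(\<Sum>y\<in>Y. r y *s y) \<in> lower y0"
    using y0M YM by (auto simp: lower_iff intro!: subspace_sum subspace_scale subspace_M)
  ultimately have "(\<Sum>y\<in>Y. r y *s y) - (\<Sum>y\<in>Y - Y1. r y *s y) \<in> lower y0"
    by (intro subspace_diff[OF sub])
  moreover have "(\<Sum>y\<in>Y. r y *s y) - (\<Sum>y\<in>Y - Y1. r y *s y) = (\<Sum>y\<in>Y1. r y *s y)"
    using sum.subset_diff[of Y1 Y "\<lambda>y. r y *s y"] fin by (simp add: Y1_def)
  moreover have "y0 \<in> H (\<Sum>y\<in>Y1. r y *s y)"
    by (rule niceD(5)[OF X]) (use Y y0 in \<open>auto simp: Y1_def\<close>)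
  ultimately show False using y0M by (simp add: lower_iff)
qed

text \<open>The notion from the proof of Ulm's theorem: \<open>y\<close> has the greatest height in
  its coset modulo \<open>span X\<close>.\<close>

definition proper :: "'b \<Rightarrow> 'b set \<Rightarrow> bool" where
  "proper y X \<longleftrightarrow> (\<forall>a\<in>span X. y \<in> H (y + a))"

text \<open>In a combination containing \<open>y\<close>, the coefficient of \<open>y\<close> is
  inverted on \<open>y\<close>; this gives an element of the coset \<open>y + span X\<close>, to
  which properness applies. Subtracting the term at \<open>y\<close> then leaves a combination over
  \<open>X\<close>.\<close>

lemma nice_insert_proper:
  assumes X: "nice X" and y: "y \<in> M" "y \<noteq> 0" "proper y X" "p *s y \<in> insert 0 X"
  shows "nice (insert y X)"
  unfolding nice_def
proof (intro conjI allI impI ballI)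
  show "finite (insert y X)" "insert y X \<subseteq> M" "0 \<notin> insert y X" using niceD[OF X] y by auto
  show "p *s x \<in> insert 0 (insert y X)" if "x \<in> insert y X" for x
    using that niceD(4)[OF X] y by blast
next
  fix Y r x assume Y: "Y \<subseteq> insert y X" "\<forall>y\<in>Y. \<not> p dvd r y" and x: "x \<in> Y"
  show "x \<in> H (\<Sum>y\<in>Y. r y *s y)"
  proof (cases "y \<in> Y")
    case False
    then have "Y \<subseteq> X" using Y by blast
    then show ?thesis using niceD(5)[OF X] Y x by blast
  next
    case True
    define a where "a = (\<Sum>x\<in>Y - {y}. r x *s x)"
    define v where "v = (\<Sum>x\<in>Y. r x *s x)"
    have fin: "finite Y" using Y niceD(1)[OF X] finite_subset by blast
    have v: "v = r y *s y + a" unfolding v_def a_def by (rule sum.remove[OF fin True])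
    have sub: "Y - {y} \<subseteq> X" using Y by blast
    have a: "a \<in> span X" unfolding a_def using sub by (intro span_sum span_scale span_base) auto
    then have aM: "a \<in> M" using nice_span[OF X] by blast
    have vM: "v \<in> M" unfolding v using y aM by (intro add_M scale_M)
    obtain s where s: "s *s r y *s y = y" using inverse_on[of "r y" y] Y True y by blast
    have "y \<in> H (y + s *s a)" using y(3) a by (auto simp: proper_def intro: span_scale)
    moreover have "y + s *s a \<in> H v"
    proof -
      have "y + s *s a = s *s v" unfolding v scale_right_distrib s ..
      then show ?thesis using vM H_self by (auto intro: subspace_scale subspace_H)
    qed
    ultimately have yv: "y \<in> H v" using H_least vM by blast
    have "x \<in> H v" if "x \<noteq> y"
    proof -
      have "a = v - r y *s y" using v by simp
      then have "a \<in> H v" using yv vM H_self by (auto intro: subspace_diff subspace_scale subspace_H)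
      moreover have "x \<in> H a" unfolding a_def using niceD(5)[OF X sub] Y x that by blast
      ultimately show ?thesis using H_least vM by blast
    qed
    then show ?thesis using yv unfolding v_def by blast
  qed
qed

text \<open>If \<open>y + a\<close> were strictly below \<open>y\<close>, then \<open>p (y + a)\<close> would be strictly below \<open>z\<close>; but no child of \<open>z\<close>
  contributes to \<open>a\<close>, so \<open>z\<close> has digit 1 in \<open>p (y + a)\<close>.\<close>

lemma immediate_proper:
  assumes X: "nice X" and z: "z \<in> X" and w: "w \<in> M" and y: "y \<in> H w" "p *s y = z"
    and imm: "\<And>v. v \<in> M \<Longrightarrow> H z \<subset> H v \<Longrightarrow> \<not> H v \<subset> H w"
    and nochild: "\<And>x. x \<in> X \<Longrightarrow> x \<in> H w \<Longrightarrow> p *s x \<noteq> z"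
  shows "proper y X"
  unfolding proper_def
proof (intro ballI, rule ccontr)
  fix a assume a: "a \<in> span X" and ny: "y \<notin> H (y + a)"
  have yM: "y \<in> M" and zM: "z \<in> M" and z0: "z \<noteq> 0" and aM: "a \<in> M"
    using in_M y w z niceD(2,3)[OF X] nice_span[OF X] a by blast+
  have y0: "y \<noteq> 0" using z0 y by auto
  have "H z \<subset> H y" using H_mult[OF yM y0] y by simp
  then have Hy: "H y = H w" using imm[OF yM] H_least[OF w y(1)] by blast
  have yaM: "y + a \<in> M" using yM aM by (rule add_M)
  have "H (y + a) \<subset> H w" using not_in_H[OF yaM yM] ny Hy by blast
  then have yaz: "y + a \<in> H z" using imm[OF yaM] H_linear[OF zM yaM] H_self[OF yaM] by blast
  have "y + a \<in> H w" using \<open>H (y + a) \<subset> H w\<close> H_self[OF yaM] by blast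
  then have "y + a - y \<in> H w" using y w by (intro subspace_diff subspace_H)
  then have aw: "a \<in> H w" by simp
  obtain Y r where Y: "finite Y" "Y \<subseteq> X" "\<And>y. y \<in> Y \<Longrightarrow> \<not> p dvd r y" "a = (\<Sum>y\<in>Y. r y *s y)"
    "\<And>y. y \<in> Y \<Longrightarrow> y \<in> H a"
    using nice_expansion[OF X a] by metis
  have Yw: "x \<in> H w" if "x \<in> Y" for x using Y(5)[OF that] H_least[OF w aw] by blast
  define T where "T = (*s) p ` Y - {0}"
  \<comment> \<open>Coefficients of digits with the same image add up and may become divisible by
    \<open>p\<close>, which is why \<open>nice_min\<close> is used below. The 1 at \<open>z\<close>
    comes from \<open>p *s y\<close>.\<close>
  define c where "c t = (if t = z then 1 else (\<Sum>x\<in>{x\<in>Y. p *s x = t}. r x))" for t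
  have zT: "z \<notin> (*s) p ` Y" using nochild Yw Y(2) by auto
  have "p *s a = (\<Sum>x\<in>Y. r x *s p *s x)"
    unfolding Y(4) scale_sum_right by (intro sum.cong refl) (rule scale_left_commute)
  also have "\<dots> = (\<Sum>t\<in>(*s) p ` Y. \<Sum>x\<in>{x\<in>Y. p *s x = t}. r x *s p *s x)"
    by (rule sum.image_gen[OF Y(1)])
  also have "\<dots> = (\<Sum>t\<in>(*s) p ` Y. c t *s t)"
  proof (rule sum.cong[OF refl])
    fix t assume "t \<in> (*s) p ` Y"
    then have "t \<noteq> z" using zT by blast
    then have "c t *s t = (\<Sum>x\<in>{x\<in>Y. p *s x = t}. r x *s t)" by (simp add: c_def scale_sum_left)
    then show "(\<Sum>x\<in>{x\<in>Y. p *s x = t}. r x *s p *s x) = c t *s t" by simp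
  qed
  also have "\<dots> = (\<Sum>t\<in>T. c t *s t)"
    unfolding T_def using Y(1) by (intro sum.mono_neutral_right) auto
  finally have pa: "p *s (y + a) = (\<Sum>t\<in>insert z T. c t *s t)"
    using zT Y(1) y(2) by (simp add: scale_right_distrib T_def c_def)
  have "z \<in> H (\<Sum>t\<in>insert z T. c t *s t)"
  proof (rule nice_min[OF X])
    show "insert z T \<subseteq> X" using z niceD(4)[OF X] Y(2) by (auto simp: T_def)
    show "\<not> p dvd c z" using not_dvd_1[OF zM z0] by (simp add: c_def)
    fix t assume t: "t \<in> insert z T"
    show "t \<in> H z"
    proof (cases "t = z")
      case True
      then show ?thesis using H_self[OF zM] by simp
    next
      case False
      then obtain x where x: "x \<in> Y" "t = p *s x" using t by (auto simp: T_def)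
      have xM: "x \<in> M" "x \<noteq> 0" using x Y(2) niceD(2,3)[OF X] by blast+
      have tM: "t \<in> M" unfolding x by (rule scale_M[OF xM(1)])
      have "H t \<subset> H w" using H_mult[OF xM] H_least[OF w Yw[OF x(1)]] unfolding x by blast
      then show ?thesis using imm[OF tM] H_linear[OF zM tM] H_self[OF tM] by blast
    qed
  qed auto
  then have "z \<in> H (p *s (y + a))" by (simp only: pa)
  moreover have "p *s (y + a) \<in> lower z"
  proof (cases "y + a = 0")
    case True
    then show ?thesis using subspace_0[OF subspace_lower[OF zM z0]] by simp
  next
    case False
    then show ?thesis using lower_mult[OF yaM] lower_mono[OF zM yaz] by blast
  qed
  ultimately show False using zM by (simp add: lower_iff)
qed

text \<open>\<open>w\<close> is first lowered to \<open>w'\<close> such that no element of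
  \<open>X\<close> has height strictly between \<open>z\<close> and \<open>w'\<close>. If some
  element of \<open>M\<close> has, a preimage of \<open>z\<close> at least as low as that element is
  proper because its height does not occur in \<open>span X\<close>; otherwise
  \<open>immediate_proper\<close> applies.\<close>

lemma child:
  assumes X: "nice X" and z: "z \<in> X" and w: "w \<in> M" and zw: "H z \<subset> H w"
  shows "\<exists>y. y \<in> H w \<and> p *s y = z \<and> nice (insert y X)"
proof (cases "\<exists>x\<in>X. x \<in> H w \<and> p *s x = z")
  case True
  then show ?thesis using X by (metis insert_absorb)
next
  case nochild: False
  have zM: "z \<in> M" and z0: "z \<noteq> 0" using z niceD(2,3)[OF X] by blast+
  define S where "S = insert w {x \<in> X. H z \<subset> H x}"
  have SM: "S \<subseteq> M" using w niceD(2)[OF X] by (auto simp: S_def)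
  have "finite (H ` S)" "H ` S \<noteq> {}" using niceD(1)[OF X] by (auto simp: S_def)
  then obtain w' where w': "w' \<in> S" and min: "\<And>x. x \<in> S \<Longrightarrow> H x \<subseteq> H w' \<Longrightarrow> H w' = H x"
    using finite_has_minimal[of "H ` S"] by auto
  have w'M: "w' \<in> M" using w' SM by blast
  have least: "H w' \<subseteq> H x" if "x \<in> S" for x
    using H_linear[OF w'M, of x] min[OF that] that SM by blast
  have zw': "H z \<subset> H w'" using w' zw by (auto simp: S_def)
  have w'w: "H w' \<subseteq> H w" by (rule least) (simp add: S_def)
  have "\<exists>y. y \<in> H w' \<and> p *s y = z \<and> proper y X"
  proof (cases "\<exists>v\<in>M. H z \<subset> H v \<and> H v \<subset> H w'")
    case True
    then obtain v where v: "v \<in> M" "H z \<subset> H v" "H v \<subset> H w'" by blast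
    then obtain y where y: "y \<in> H v" "p *s y = z" using H_div[OF zM v(1)] by blast
    have yM: "y \<in> M" using in_M v y by blast
    have y0: "y \<noteq> 0" using y z0 by auto
    have "y \<in> H (y + a)" if a: "a \<in> span X" for a
    proof (rule ccontr)
      assume ny: "y \<notin> H (y + a)"
      have aM: "a \<in> M" using a nice_span[OF X] by blast
      have Ha: "H a = H y"
        using H_add_cancel[OF yM aM] ny yM aM add_M by (simp add: lower_iff)
      have "a \<noteq> 0" using Ha y0 H_self[OF yM] H_zero by auto
      then obtain x where x: "x \<in> X" "H x = H y" using nice_height[OF X a] Ha by auto
      have "H z \<subset> H x" using H_mult[OF yM y0] y(2) x(2) by simp
      then have "H w' \<subseteq> H x" using x(1) by (intro least) (simp add: S_def)
      then show False using H_least[OF v(1) y(1)] x(2) v(3) by blast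
    qed
    then show ?thesis using y v(3) unfolding proper_def by blast
  next
    case False
    obtain y where y: "y \<in> H w'" "p *s y = z" using H_div[OF zM w'M zw'] by blast
    have "proper y X"
      by (rule immediate_proper[OF X z w'M y]) (use False nochild w'w in blast)+
    then show ?thesis using y by blast
  qed
  then obtain y where y: "y \<in> H w'" "p *s y = z" "proper y X" by blast
  have "nice (insert y X)"
    by (rule nice_insert_proper[OF X]) (use y in_M[OF w'M] z z0 in auto)
  then show ?thesis using y w'w by blast
qed

text \<open>The bound on \<open>X' - X\<close> is recorded because properness with respect to
  \<open>X'\<close> must later be deduced from what is known about \<open>X\<close>.\<close>

lemma children:
  assumes "finite Z" "nice X" "Z \<subseteq> X" "\<And>z. z \<in> Z \<Longrightarrow> w z \<in> M \<and> H z \<subset> H (w z)"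
  shows "\<exists>X' f. nice X' \<and> X \<subseteq> X' \<and> X' - X \<subseteq> f ` Z \<and>
    (\<forall>z\<in>Z. f z \<in> X' \<and> f z \<in> H (w z) \<and> p *s f z = z)"
  using assms
proof (induction Z rule: finite_induct)
  case empty
  then show ?case by auto
next
  case (insert z Z)
  then obtain X' f where X': "nice X'" "X \<subseteq> X'" "X' - X \<subseteq> f ` Z"
    "\<forall>z\<in>Z. f z \<in> X' \<and> f z \<in> H (w z) \<and> p *s f z = z" by auto
  have z: "z \<in> X'" using X'(2) insert.prems by blast
  obtain y where y: "y \<in> H (w z)" "p *s y = z" "nice (insert y X')"
    using child[OF X'(1) z, of "w z"] insert.prems(3)[of z] by auto
  have "insert y X' - X \<subseteq> (f(z := y)) ` insert z Z" using X'(3) insert.hyps(2) by auto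
  then show ?case using y X' insert.hyps(2)
    by (intro exI[of _ "insert y X'"] exI[of _ "f(z := y)"]) auto
qed

text \<open>If the heights in the coset \<open>x + span X\<close> had no maximum, each of them would
  be the height of a difference of two coset members by \<open>H_add_cancel\<close>, hence occur in
  \<open>span X\<close>; but only finitely many heights occur there.\<close>

lemma proper_representative:
  assumes X: "nice X" and x: "x \<in> M"
  obtains b where "b \<in> span X" "proper (x + b) X"
proof -
  define K where "K = (\<lambda>a. H (x + a)) ` span X"
  have M: "x + a \<in> M" if "a \<in> span X" for a using that x nice_span[OF X] add_M by blast
  have "\<exists>a\<in>span X. \<forall>a'\<in>span X. \<not> H (x + a') \<subset> H (x + a)"
  proof (rule ccontr)
    assume *: "\<not> ?thesis"
    have "H (x + a) \<in> insert {0} (H ` X)" if a: "a \<in> span X" for a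
    proof -
      obtain a' where a': "a' \<in> span X" "H (x + a') \<subset> H (x + a)" using * a by blast
      have d: "a' - a \<in> span X" using a a' by (intro span_diff)
      have "(x + a) + (a' - a) \<in> lower (x + a)" using a' M by (simp add: lower_def)
      then have "H (a' - a) = H (x + a)" using d nice_span[OF X] M[OF a] by (intro H_add_cancel) auto
      then show ?thesis using nice_height[OF X d] H_zero by (cases "a' - a = 0") auto
    qed
    then have "K \<subseteq> insert {0} (H ` X)" by (auto simp: K_def)
    then have "finite K" using niceD(1)[OF X] finite_subset by blast
    moreover have "K \<noteq> {}" using span_zero by (auto simp: K_def)
    ultimately show False using finite_has_minimal[of K] * by (fastforce simp: K_def)
  qed
  then obtain b where b: "b \<in> span X" "\<And>a. a \<in> span X \<Longrightarrow> \<not> H (x + a) \<subset> H (x + b)" by blast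
  have "x + b \<in> H (x + b + a)" if "a \<in> span X" for a
    using b(2)[of "b + a"] not_in_H[OF M M, of "b + a" b] b(1) that
    by (auto simp: add.assoc intro: span_add)
  then show ?thesis using b(1) that unfolding proper_def by blast
qed

end

section \<open>Absorbing an element into a nice set\<close>

context filtered_module
begin

text \<open>The digits of \<open>p x\<close> are elements \<open>z\<close> strictly below \<open>x\<close>. Subtracting from \<open>x\<close> children of these \<open>z\<close>
  leaves an element killed by \<open>p\<close>. It stays proper if the children are strictly below \<open>x\<close> or already
  present; if this fails for some \<open>z0\<close>, then \<open>x\<close> itself is used to make a child of \<open>z0\<close>.\<close>

lemma nice_extend_proper:
  assumes X: "nice X" and x: "x \<in> M" "proper x X" and px: "p *s x \<in> span X"
  shows "\<exists>X'. nice X' \<and> X \<subseteq> X' \<and> x \<in> span X'"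
proof (cases "x = 0")
  case True
  then show ?thesis using X span_zero by blast
next
  case x0: False
  obtain Z c where Z: "finite Z" "Z \<subseteq> X" "\<And>z. z \<in> Z \<Longrightarrow> \<not> p dvd c z" "p *s x = (\<Sum>z\<in>Z. c z *s z)"
    "\<And>z. z \<in> Z \<Longrightarrow> z \<in> H (p *s x)"
    using nice_expansion[OF X px] by metis
  have zx: "H z \<subset> H x" if "z \<in> Z" for z
    using H_least[OF scale_M[OF x(1)] Z(5)[OF that]] H_mult[OF x(1) x0] by blast
  have ZM: "z \<in> M" "z \<noteq> 0" if "z \<in> Z" for z using that Z(2) niceD(2,3)[OF X] by auto
  show ?thesis
  proof (cases "\<exists>z0\<in>Z. (\<forall>v\<in>M. H z0 \<subset> H v \<longrightarrow> \<not> H v \<subset> H x) \<and> (\<forall>y\<in>X. y \<in> H x \<longrightarrow> p *s y \<noteq> z0)")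
    case True
    then obtain z0 where z0: "z0 \<in> Z" "\<And>v. v \<in> M \<Longrightarrow> H z0 \<subset> H v \<Longrightarrow> \<not> H v \<subset> H x"
      "\<And>y. y \<in> X \<Longrightarrow> y \<in> H x \<Longrightarrow> p *s y \<noteq> z0" by blast
    have ZX: "Z - {z0} \<subseteq> X" using Z(2) by blast
    obtain X' f where X': "nice X'" "X \<subseteq> X'" "X' - X \<subseteq> f ` (Z - {z0})"
      and f: "\<And>z. z \<in> Z - {z0} \<Longrightarrow> f z \<in> X' \<and> f z \<in> H x \<and> p *s f z = z"
      using children[OF _ X ZX, of "\<lambda>_. x"] Z(1) x(1) zx by auto
    define d where "d = (\<Sum>z\<in>Z - {z0}. c z *s f z)"
    have dX': "d \<in> span X'" unfolding d_def using f by (intro span_sum span_scale span_base) auto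
    have dx: "d \<in> H x" unfolding d_def using f x(1) by (intro subspace_sum subspace_scale subspace_H) auto
    have xdx: "x - d \<in> H x" using dx x(1) H_self by (intro subspace_diff subspace_H)
    have "p *s d = (\<Sum>z\<in>Z - {z0}. c z *s z)"
      unfolding d_def scale_sum_right
    proof (rule sum.cong[OF refl])
      fix z assume "z \<in> Z - {z0}"
      then show "p *s c z *s f z = c z *s z" using f by (metis scale_left_commute)
    qed
    then have pxd: "p *s (x - d) = c z0 *s z0"
      using sum.remove[OF Z(1) z0(1), of "\<lambda>z. c z *s z"] Z(4) by (simp add: scale_right_diff_distrib)
    \<comment> \<open>\<open>x - d\<close> and \<open>z0\<close> are both killed by
      \<open>p ^ (n + m)\<close>, so a single inverse \<open>s\<close> of \<open>c z0\<close> works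
      for both, and \<open>s *s (x - d)\<close> becomes a child of \<open>z0\<close>.\<close>
    obtain n where n: "p ^ n *s (x - d) = 0" using torsion in_M[OF x(1) xdx] by blast
    obtain m where m: "p ^ m *s z0 = 0" using torsion ZM z0 by blast
    have "p ^ (n + m) *s (x - d) = p ^ m *s p ^ n *s (x - d)" "p ^ (n + m) *s z0 = p ^ n *s p ^ m *s z0"
      by (simp_all add: power_add mult.commute)
    then obtain s where s: "s *s c z0 *s (x - d) = x - d" "s *s c z0 *s z0 = z0"
      using inverse_modulo_power[OF Z(3)[OF z0(1)], of "n + m"] n m by (metis scale_zero_right)
    define y where "y = s *s (x - d)"
    have y: "y \<in> H x" unfolding y_def using xdx x(1) by (intro subspace_scale subspace_H)
    have py: "p *s y = z0" unfolding y_def using pxd s(2) by (metis scale_left_commute)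
    have "proper y X'"
    proof (rule immediate_proper[OF X'(1) _ x(1) y py z0(2)])
      show "z0 \<in> X'" using z0(1) Z(2) X'(2) by blast
      show "p *s t \<noteq> z0" if "t \<in> X'" "t \<in> H x" for t
      proof (cases "t \<in> X")
        case False
        then have "t \<in> f ` (Z - {z0})" using \<open>t \<in> X'\<close> X'(3) by blast
        then obtain z where "z \<in> Z - {z0}" "t = f z" by blast
        then show ?thesis using f[of z] by simp
      qed (use that z0(3) in blast)
    qed
    moreover have "z0 \<noteq> 0" using ZM z0(1) by blast
    then have "y \<noteq> 0" using py by auto
    moreover have "p *s y \<in> insert 0 X'" using py z0(1) ZX Z(2) X'(2) by blast
    ultimately have "nice (insert y X')"
      using in_M[OF x(1) y] X'(1) by (intro nice_insert_proper)
    moreover have "x \<in> span (insert y X')"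
    proof -
      have "x = c z0 *s y + d" unfolding y_def using s(1) by (metis diff_add_cancel scale_left_commute)
      moreover have "d \<in> span (insert y X')" using dX' span_mono[of X' "insert y X'"] by blast
      ultimately show ?thesis by (metis insertI1 span_add span_base span_scale)
    qed
    ultimately show ?thesis using X'(2) by blast
  next
    case False
    \<comment> \<open>The digits whose children have to be created. By the case assumption each
      admits an element \<open>w z\<close> of height strictly between, so the new children can be
      put strictly below \<open>x\<close>.\<close>
    define Z1 where "Z1 = {z \<in> Z. \<forall>y\<in>X. y \<in> H x \<longrightarrow> p *s y \<noteq> z}"
    have "\<exists>v. v \<in> M \<and> H z \<subset> H v \<and> H v \<subset> H x" if "z \<in> Z1" for z
      using False that unfolding Z1_def by blast
    then obtain w where w: "\<And>z. z \<in> Z1 \<Longrightarrow> w z \<in> M \<and> H z \<subset> H (w z) \<and> H (w z) \<subset> H x" by metis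
    obtain g where g: "\<And>z. z \<in> Z - Z1 \<Longrightarrow> g z \<in> X \<and> g z \<in> H x \<and> p *s g z = z"
    proof -
      have "\<forall>z\<in>Z - Z1. \<exists>y. y \<in> X \<and> y \<in> H x \<and> p *s y = z" by (auto simp: Z1_def)
      then show ?thesis using that by metis
    qed
    obtain X' f where X': "nice X'" "X \<subseteq> X'" "X' - X \<subseteq> f ` Z1"
      and f: "\<And>z. z \<in> Z1 \<Longrightarrow> f z \<in> X' \<and> f z \<in> H (w z) \<and> p *s f z = z"
    proof -
      have "finite Z1" "Z1 \<subseteq> X" using Z(1,2) by (auto simp: Z1_def)
      then show ?thesis using children[OF _ X, of Z1 w] w that by blast
    qed
    note sub = subspace_lower[OF x(1) x0]
    have flow: "f z \<in> lower x" if z: "z \<in> Z1" for z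
    proof -
      have "H (f z) \<subseteq> H (w z)" "f z \<in> M" using f[OF z] w[OF z] H_least in_M by blast+
      then show ?thesis using w[OF z] by (auto simp: lower_def)
    qed
    \<comment> \<open>\<open>d\<close> and \<open>e\<close> collect the old and the new children, so
      that \<open>p *s (d + e) = p *s x\<close>.\<close>
    define d where "d = (\<Sum>z\<in>Z - Z1. c z *s g z)"
    define e where "e = (\<Sum>z\<in>Z1. c z *s f z)"
    have dX: "d \<in> span X" unfolding d_def using g by (intro span_sum span_scale span_base) auto
    have dx: "d \<in> H x" unfolding d_def using g x(1) by (intro subspace_sum subspace_scale subspace_H) auto
    have eX': "e \<in> span X'" unfolding e_def using f by (intro span_sum span_scale span_base) auto
    have ex: "e \<in> lower x" unfolding e_def using flow by (intro subspace_sum[OF sub] subspace_scale[OF sub])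
    have deX': "d + e \<in> span X'" using dX eX' span_mono[OF X'(2)] by (blast intro: span_add)
    define y where "y = x - (d + e)"
    have yx: "y \<in> H x" unfolding y_def
      using dx ex lower_sub_H x(1) H_self by (blast intro: subspace_diff subspace_add subspace_H)
    have "p *s d = (\<Sum>z\<in>Z - Z1. c z *s z)" unfolding d_def scale_sum_right
    proof (rule sum.cong[OF refl])
      fix z assume "z \<in> Z - Z1"
      then show "p *s c z *s g z = c z *s z" using g by (metis scale_left_commute)
    qed
    moreover have "p *s e = (\<Sum>z\<in>Z1. c z *s z)" unfolding e_def scale_sum_right
    proof (rule sum.cong[OF refl])
      fix z assume "z \<in> Z1"
      then show "p *s c z *s f z = c z *s z" using f by (metis scale_left_commute)
    qed
    moreover have "Z1 \<subseteq> Z" by (auto simp: Z1_def)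
    ultimately have py: "p *s y = 0"
      using sum.subset_diff[of Z1 Z "\<lambda>z. c z *s z"] Z(1,4)
      by (simp add: y_def scale_right_diff_distrib scale_right_distrib)
    \<comment> \<open>The new elements are strictly below \<open>x\<close>, and adding such an
      element does not change the height of \<open>x + a\<close>. Hence properness of
      \<open>x\<close> passes from \<open>X\<close> to \<open>X'\<close>, and then to
      \<open>y\<close>.\<close>
    have "\<exists>a\<in>span X. \<exists>l\<in>lower x. b = a + l" if "b \<in> span X'" for b
      using that
    proof (induction rule: span_induct_alt)
      case base
      then show ?case using span_zero subspace_0[OF sub] by (metis add_0)
    next
      case (step r t b)
      then obtain a l where al: "a \<in> span X" "l \<in> lower x" "b = a + l" by blast
      show ?case
      proof (cases "t \<in> X")
        case True
        then have "r *s t + a \<in> span X" using al(1) by (intro span_add span_scale) (auto intro: span_base)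
        then show ?thesis using al by (metis add.assoc)
      next
        case False
        then have "t \<in> lower x" using step(1) X'(3) flow by auto
        then have "r *s t + l \<in> lower x" using al sub by (intro subspace_add subspace_scale)
        then show ?thesis using al by (metis add.left_commute)
      qed
    qed note split = this
    have "proper y X'" unfolding proper_def
    proof
      fix b assume "b \<in> span X'"
      then have "b - (d + e) \<in> span X'" using deX' by (intro span_diff)
      then obtain a l where al: "a \<in> span X" "l \<in> lower x" "b - (d + e) = a + l" using split by blast
      have aM: "x + a \<in> M" using al nice_span[OF X] x(1) add_M by blast
      have xa: "x \<in> H (x + a)" using x(2) al(1) by (auto simp: proper_def)
      have "l \<in> lower (x + a)" using al(2) H_least[OF aM xa] by (auto simp: lower_def)
      then have "H (x + a + l) = H (x + a)" using aM by (intro H_add_lower)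
      moreover have "y + b = x + a + l" using al(3) by (simp add: y_def algebra_simps)
      ultimately show "y \<in> H (y + b)" using xa yx H_least[OF aM xa] by auto
    qed
    have xy: "x = y + (d + e)" by (simp add: y_def)
    show ?thesis
    proof (cases "y = 0")
      case True
      then show ?thesis using xy deX' X' by auto
    next
      case False
      then have "nice (insert y X')"
        using X'(1) \<open>proper y X'\<close> py in_M[OF x(1) yx] by (intro nice_insert_proper) auto
      moreover have "x \<in> span (insert y X')"
        unfolding xy using deX' span_mono[of X' "insert y X'"] by (blast intro: span_add span_base)
      ultimately show ?thesis using X'(2) by blast
    qed
  qed
qed

text \<open>Induction on the exponent of \<open>x\<close>: first \<open>p *s x\<close> is absorbed,
  then \<open>x\<close> is replaced by a proper representative, which differs from it by an element
  already in the span.\<close>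

lemma nice_extend:
  assumes "nice X" "x \<in> M"
  shows "\<exists>X'. nice X' \<and> X \<subseteq> X' \<and> x \<in> span X'"
proof -
  obtain n where "p ^ n *s x = 0" using torsion assms by blast
  then show ?thesis using assms
  proof (induction n arbitrary: X x)
    case 0
    then show ?case using span_zero by auto
  next
    case (Suc n)
    have "p ^ n *s p *s x = 0" using Suc.prems(1) by (simp add: mult.commute)
    then obtain X1 where X1: "nice X1" "X \<subseteq> X1" "p *s x \<in> span X1"
      using Suc.IH Suc.prems scale_M by blast
    obtain b where b: "b \<in> span X1" "proper (x + b) X1"
      using proper_representative[OF X1(1) Suc.prems(3)] by blast
    have "p *s (x + b) \<in> span X1"
      using X1(3) b(1) by (simp add: scale_right_distrib span_add span_scale)
    moreover have "x + b \<in> M" using b nice_span[OF X1(1)] Suc.prems(3) add_M by blast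
    ultimately obtain X2 where X2: "nice X2" "X1 \<subseteq> X2" "x + b \<in> span X2"
      using nice_extend_proper[OF X1(1)] b(2) by blast
    have "x + b - b \<in> span X2" using X2 b(1) span_mono[OF X2(2)] by (blast intro: span_diff)
    then show ?case using X1 X2 by auto
  qed
qed

lemma nice_tree_basis:
  assumes inc: "\<And>n. F n \<subseteq> F (Suc n)" and nice: "\<And>n. nice (F n)"
  shows "tree_basis p (\<Union>n. F n)"
  unfolding tree_basis_def
proof (intro conjI ballI allI impI)
  show "p *s x \<in> insert 0 (\<Union>n. F n)" if "x \<in> (\<Union>n. F n)" for x
    using that niceD(4)[OF nice] by blast
  show "\<exists>n. p ^ n *s x = 0" if "x \<in> (\<Union>n. F n)" for x
    using that niceD(2)[OF nice] torsion by blast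
next
  fix Y r assume Y: "finite Y" "Y \<subseteq> (\<Union>n. F n)" "\<forall>y\<in>Y. \<not> p dvd r y" "(\<Sum>y\<in>Y. r y *s y) = 0"
  have mono: "F m \<subseteq> F n" if "m \<le> n" for m n using lift_Suc_mono_le[of F, OF inc that] .
  obtain N where N: "\<And>y. y \<in> Y \<Longrightarrow> y \<in> F (N y)" using Y(2) by (metis UN_E subsetD)
  have YF: "Y \<subseteq> F (Max (N ` Y))" using N mono[OF Max_ge] Y(1) by blast
  have "y = 0" if "y \<in> Y" for y
    using niceD(5)[OF nice YF _ that, of r] Y(3,4) H_zero by auto
  then show "Y = {}" using YF niceD(3)[OF nice] by blast
qed

end

theorem (in primary_module) tree_basis_exists:
  assumes "countable C" "C \<subseteq> M" "M \<subseteq> span C"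
  shows "\<exists>X. tree_basis p X \<and> span X = M"
proof -
  obtain H where "filtered_module scale p M H" using filtration_exists by blast
  then interpret filtered_module scale p M H .
  \<comment> \<open>One generator is absorbed at each step; 0 is added so that the enumeration
    exists even if \<open>C\<close> is empty.\<close>
  define c where "c = from_nat_into (insert 0 C)"
  have c: "range c = insert 0 C"
    unfolding c_def using assms(1) by (intro range_from_nat_into) auto
  have "\<exists>F. \<forall>n. nice (F n) \<and> (F n \<subseteq> F (Suc n) \<and> c n \<in> span (F (Suc n)))"
  proof (rule dependent_nat_choice)
    show "\<exists>X. nice X" by (intro exI[of _ "{}"]) (simp add: nice_def)
    fix X n assume "nice X"
    moreover have "c n \<in> M" using rangeI[of c n] assms(2) zero_M unfolding c by auto
    ultimately show "\<exists>X'. nice X' \<and> X \<subseteq> X' \<and> c n \<in> span X'" by (rule nice_extend)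
  qed
  then obtain F where F: "\<And>n. nice (F n)" "\<And>n. F n \<subseteq> F (Suc n)" "\<And>n. c n \<in> span (F (Suc n))" by auto
  have "C \<subseteq> span (\<Union>n. F n)"
  proof
    fix x assume "x \<in> C"
    then have "x \<in> range c" unfolding c by simp
    then obtain n where "x = c n" by blast
    then show "x \<in> span (\<Union>n. F n)" using F(3)[of n] span_mono[of "F (Suc n)" "\<Union>n. F n"] by blast
  qed
  then have "M \<subseteq> span (\<Union>n. F n)" using assms(3) by (metis order.trans span_minimal subspace_span)
  moreover have "span (\<Union>n. F n) \<subseteq> M" using niceD(2)[OF F(1)] subspace_M by (intro span_minimal) auto
  moreover have "tree_basis p (\<Union>n. F n)" using F(1,2) by (intro nice_tree_basis)
  ultimately show ?thesis by blast
qed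

section \<open>Reciprocal polynomials\<close>

text \<open>A nonzero element of least degree in the ideal generated by \<open>p\<close> and
  \<open>r\<close> divides both. Were it not a unit, \<open>p\<close> would divide it and hence
  \<open>r\<close>.\<close>

lemma irreducible_poly_bezout:
  fixes p r :: "'f::field poly"
  assumes p: "irreducible p" and r: "\<not> p dvd r"
  shows "\<exists>s q. s * r = 1 + q * p"
proof -
  define I where "I = {s * r + q * p | s q. True}"
  have pI: "p \<in> I" unfolding I_def by (rule CollectI, rule exI[of _ 0], rule exI[of _ 1]) simp
  have rI: "r \<in> I" unfolding I_def by (rule CollectI, rule exI[of _ 1], rule exI[of _ 0]) simp
  have lin: "a - c * b \<in> I" if "a \<in> I" "b \<in> I" for a b c
  proof -
    from that obtain s q s' q' where "a = s * r + q * p" "b = s' * r + q' * p" by (auto simp: I_def)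
    then have "a - c * b = (s - c * s') * r + (q - c * q') * p" by (simp add: algebra_simps)
    then show ?thesis unfolding I_def by blast
  qed
  define g where "g = arg_min degree (\<lambda>g. g \<in> I \<and> g \<noteq> 0)"
  have g: "g \<in> I" "g \<noteq> 0" and min: "\<And>h. h \<in> I \<Longrightarrow> h \<noteq> 0 \<Longrightarrow> degree g \<le> degree h"
    using arg_min_natI[of "\<lambda>g. g \<in> I \<and> g \<noteq> 0" p degree] pI p
      arg_min_nat_le[of "\<lambda>g. g \<in> I \<and> g \<noteq> 0" _ degree] by (auto simp: g_def irreducible_def)
  have dvd: "g dvd h" if h: "h \<in> I" for h
  proof (rule ccontr)
    assume ndvd: "\<not> g dvd h"
    then have nz: "h mod g \<noteq> 0" by (simp add: dvd_eq_mod_eq_0)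
    have "h mod g = h - (h div g) * g" by (simp add: minus_div_mult_eq_mod)
    then have "h mod g \<in> I" using lin[OF h g(1)] by simp
    then show False using min nz degree_mod_less'[OF g(2) nz] by fastforce
  qed
  obtain k where k: "p = g * k" using dvd[OF pI] by (auto simp: dvd_def)
  have "g dvd 1"
  proof (rule ccontr)
    assume "\<not> g dvd 1"
    then have "k dvd 1" using p k irreducibleD by blast
    then have "p dvd g" using k by (simp add: mult_unit_dvd_iff)
    then show False using r dvd[OF rI] dvd_trans by blast
  qed
  then obtain h where "1 = g * h" by (auto simp: dvd_def)
  moreover obtain s q where "g = s * r + q * p" using g(1) by (auto simp: I_def)
  ultimately have "(h * s) * r = 1 + (- h * q) * p" by (simp add: algebra_simps)
  then show ?thesis by blast
qed

lemma irreducible_poly_not_dvd_mult: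
  fixes p a b :: "'f::field poly"
  assumes p: "irreducible p" and ab: "\<not> p dvd a" "\<not> p dvd b"
  shows "\<not> p dvd a * b"
proof
  assume dvd: "p dvd a * b"
  obtain s q where sq: "s * a = 1 + q * p" using irreducible_poly_bezout[OF p ab(1)] by blast
  have "s * (a * b) = (s * a) * b" by (simp add: mult.assoc)
  also have "\<dots> = b + p * (q * b)" unfolding sq by (simp add: algebra_simps)
  finally have "p dvd b + p * (q * b)" using dvd by (metis dvd_mult)
  then show False using ab(2) by (simp add: dvd_add_left_iff)
qed

lemma irreducible_poly_not_dvd_prod:
  fixes p :: "'f::field poly"
  assumes p: "irreducible p" and "finite F" "\<And>q. q \<in> F \<Longrightarrow> \<not> p dvd f q"
  shows "\<not> p dvd prod f F"
  using assms(2,3)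
proof (induction F rule: finite_induct)
  case empty
  then show ?case using p by (simp add: irreducible_def)
next
  case (insert q F)
  then show ?case using irreducible_poly_not_dvd_mult[OF p] by simp
qed

lemma irreducible_poly_not_dvd_power:
  fixes p :: "'f::field poly"
  assumes p: "irreducible p" and q: "\<not> p dvd q"
  shows "\<not> p dvd q ^ n"
proof (induction n)
  case 0
  then show ?case using p by (simp add: irreducible_def)
next
  case (Suc n)
  then show ?case using irreducible_poly_not_dvd_mult[OF p q] by simp
qed

lemma poly_power_factor:
  fixes p q :: "'f::field poly"
  assumes "degree p > 0" "q \<noteq> 0"
  shows "\<exists>n q'. q = p ^ n * q' \<and> \<not> p dvd q'"
  using assms(2)
proof (induction "degree q" arbitrary: q rule: less_induct)
  case less
  show ?case
  proof (cases "p dvd q")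
    case False
    then show ?thesis by (intro exI[of _ 0] exI[of _ q]) simp
  next
    case True
    then obtain k where k: "q = p * k" by (auto simp: dvd_def)
    then have "degree k < degree q" "k \<noteq> 0" using assms(1) less.prems by (auto simp: degree_mult_eq)
    then obtain n q' where "k = p ^ n * q'" "\<not> p dvd q'" using less.hyps by blast
    then show ?thesis using k by (intro exI[of _ "Suc n"] exI[of _ q']) (simp add: mult.assoc)
  qed
qed

lemma monic_irreducible_factor:
  fixes q :: "'f::field poly"
  assumes "degree q > 0"
  shows "\<exists>p. irreducible p \<and> lead_coeff p = 1 \<and> p dvd q"
proof -
  define d where "d = arg_min degree (\<lambda>d. d dvd q \<and> degree d > 0)"
  have d: "d dvd q" "degree d > 0" and min: "\<And>h. h dvd q \<Longrightarrow> degree h > 0 \<Longrightarrow> degree d \<le> degree h"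
    using arg_min_natI[of "\<lambda>d. d dvd q \<and> degree d > 0" q degree] assms
      arg_min_nat_le[of "\<lambda>d. d dvd q \<and> degree d > 0" _ degree] by (auto simp: d_def)
  define p where "p = smult (inverse (lead_coeff d)) d"
  have d0: "d \<noteq> 0" using d by auto
  have p: "p dvd q" "degree p = degree d" "lead_coeff p = 1"
    using d d0 by (auto simp: p_def smult_dvd_iff)
  have "irreducible p"
  proof (rule irreducibleI)
    show "p \<noteq> 0" using p by auto
    show "\<not> p dvd 1" using p(2) d(2) by (auto simp: is_unit_iff_degree d0 p_def)
    fix a b assume ab: "p = a * b"
    then have nz: "a \<noteq> 0" "b \<noteq> 0" using \<open>p \<noteq> 0\<close> by auto
    have deg: "degree p = degree a + degree b" using ab nz by (simp add: degree_mult_eq)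
    show "a dvd 1 \<or> b dvd 1"
    proof (cases "degree a = 0")
      case True
      then show ?thesis using nz by (simp add: is_unit_iff_degree)
    next
      case False
      then have "degree d \<le> degree a" using min p(1) ab by (meson dvd_trans dvd_triv_left gr0I)
      then show ?thesis using deg p(2) nz by (simp add: is_unit_iff_degree)
    qed
  qed
  then show ?thesis using p by blast
qed

lemma monic_irreducible_dvd_eq:
  fixes p q :: "'f::field poly"
  assumes "irreducible p" "irreducible q" "lead_coeff p = 1" "lead_coeff q = 1" "p dvd q"
  shows "p = q"
proof -
  obtain k where k: "q = p * k" using assms(5) by (auto simp: dvd_def)
  then have "k dvd 1" using assms(1,2) irreducibleD by (metis irreducible_not_unit)
  moreover have "k \<noteq> 0" using k assms(2) by auto
  ultimately have "degree k = 0" by (simp add: is_unit_iff_degree)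
  then obtain c where "k = [:c:]" by (rule degree_eq_zeroE)
  then show ?thesis using k assms(3,4) by (cases "c = 0") auto
qed

text \<open>The monic polynomial whose roots are the inverses of the roots of \<open>p\<close>.\<close>

definition reciprocal_poly :: "'f::field poly \<Rightarrow> 'f poly" where
  "reciprocal_poly p = smult (inverse (coeff p 0)) (reflect_poly p)"

text \<open>The condition on \<open>coeff p 0\<close> excludes just the indeterminate, whose
  component is zero for an invertible operator. For the others the reciprocal polynomial has the
  same degree.\<close>

definition monic_primes :: "'f::field poly set" where
  "monic_primes = {p. irreducible p \<and> lead_coeff p = 1 \<and> coeff p 0 \<noteq> 0}"

lemma reciprocal_reciprocal:
  assumes "p \<in> monic_primes"
  shows "reciprocal_poly (reciprocal_poly p) = p"
  using assms by (auto simp: reciprocal_poly_def monic_primes_def reflect_poly_smult)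

lemma reciprocal_monic_prime:
  assumes "p \<in> monic_primes"
  shows "reciprocal_poly p \<in> monic_primes"
proof -
  have p: "irreducible p" "lead_coeff p = 1" "coeff p 0 \<noteq> 0" using assms by (auto simp: monic_primes_def)
  define r where "r = reciprocal_poly p"
  have r: "degree r = degree p" "lead_coeff r = 1" "coeff r 0 \<noteq> 0" "r \<noteq> 0"
    using p by (auto simp: r_def reciprocal_poly_def coeff_reflect_poly)
  have "irreducible r"
  proof (rule irreducibleI)
    show "r \<noteq> 0" by fact
    have "p \<noteq> 0" using p by auto
    then show "\<not> r dvd 1" using p(1) r(1,4) by (auto simp: is_unit_iff_degree irreducible_def)
    fix a b assume ab: "r = a * b"
    have nz: "a \<noteq> 0" "b \<noteq> 0" "coeff a 0 \<noteq> 0" "coeff b 0 \<noteq> 0"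
      using ab r by (auto simp: coeff_mult_0)
    have "p = smult (inverse (coeff r 0)) (reflect_poly a) * reflect_poly b"
      using reciprocal_reciprocal[OF assms] unfolding r_def[symmetric]
      by (simp add: reciprocal_poly_def ab reflect_poly_mult)
    then have "smult (inverse (coeff r 0)) (reflect_poly a) dvd 1 \<or> reflect_poly b dvd 1"
      using p(1) irreducibleD by blast
    then show "a dvd 1 \<or> b dvd 1" using nz r(3) by (simp add: is_unit_iff_degree)
  qed
  then show ?thesis using r by (simp add: monic_primes_def r_def)
qed

section \<open>Primary components of an operator\<close>

text \<open>Horner evaluation of \<open>q\<close> at \<open>u\<close>; it turns \<open>V\<close>
  into a module over the polynomial ring.\<close>

definition poly_act :: "('f::field \<Rightarrow> 'v::ab_group_add \<Rightarrow> 'v) \<Rightarrow> ('v \<Rightarrow> 'v) \<Rightarrow> 'f poly \<Rightarrow> 'v \<Rightarrow> 'v" where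
  "poly_act scale u q x = fold_coeffs (\<lambda>a f x. scale a x + u (f x)) q (\<lambda>_. 0) x"

locale operator = vector_space scale
  for scale :: "'f::field \<Rightarrow> 'v::ab_group_add \<Rightarrow> 'v" +
  fixes u :: "'v \<Rightarrow> 'v"
  assumes u_add: "u (x + y) = u x + u y" and u_scale: "u (scale a x) = scale a (u x)"
begin

abbreviation act :: "'f poly \<Rightarrow> 'v \<Rightarrow> 'v" where "act \<equiv> poly_act scale u"

lemma u_zero [simp]: "u 0 = 0"
  using u_scale[of 0 0] by simp

lemma act_0 [simp]: "act 0 x = 0"
  by (simp add: poly_act_def)

lemma act_pCons [simp]: "act (pCons a q) x = scale a x + u (act q x)"
  by (cases "q = 0 \<and> a = 0") (auto simp: poly_act_def)

lemma act_plus: "act (q + r) x = act q x + act r x"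
  by (induction q r rule: poly_induct2) (simp_all add: scale_left_distrib u_add algebra_simps)

lemma act_smult: "act (smult a q) x = scale a (act q x)"
  by (induction q) (simp_all add: u_scale scale_right_distrib)

lemma act_add_right: "act q (x + y) = act q x + act q y"
  by (induction q) (simp_all add: u_add scale_right_distrib algebra_simps)

lemma act_times: "act (q * r) x = act q (act r x)"
  by (induction q) (simp_all add: act_plus act_smult)

lemma act_1 [simp]: "act 1 x = x"
  by (simp add: one_pCons)

sublocale act: module act
  by unfold_locales (simp_all add: act_plus act_add_right act_times)

lemma act_scale: "act q (scale a x) = scale a (act q x)"
  by (induction q) (simp_all add: u_scale scale_right_distrib mult.commute)

lemma act_u: "act q (u x) = u (act q x)"
  by (induction q) (simp_all add: u_scale u_add)

lemma act_const: "act [:a:] x = scale a x"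
  by simp

lemma act_monom: "act (monom a n) x = scale a ((u ^^ n) x)"
  by (induction n) (simp_all add: monom_Suc monom_0 u_scale)

text \<open>\<open>h\<close> is controlled on \<open>M\<close> only, because it will be a map that
  is meaningful on a single component.\<close>

lemma intertwine:
  assumes "operator scale2 w"
    and M: "\<And>x y. x \<in> M \<Longrightarrow> y \<in> M \<Longrightarrow> x + y \<in> M" "\<And>a x. x \<in> M \<Longrightarrow> scale a x \<in> M"
      "\<And>x. x \<in> M \<Longrightarrow> u x \<in> M"
    and h: "\<And>x y. x \<in> M \<Longrightarrow> y \<in> M \<Longrightarrow> h (x + y) = h x + h y"
      "\<And>a x. x \<in> M \<Longrightarrow> h (scale a x) = scale2 a (h x)" "\<And>x. x \<in> M \<Longrightarrow> h (u x) = w (h x)"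
    and x: "x \<in> M"
  shows "act q x \<in> M \<and> h (act q x) = poly_act scale2 w q (h x)"
proof -
  interpret w: operator scale2 w by fact
  show ?thesis
  proof (induction q)
    case 0
    have "scale 0 x \<in> M" "h (scale 0 x) = scale2 0 (h x)" using M(2) h(2) x by blast+
    then show ?case by simp
  next
    case (pCons a q)
    then show ?case using M h x by simp
  qed
qed

definition component :: "'f poly \<Rightarrow> 'v set" where
  "component p = {x. \<exists>n. act (p ^ n) x = 0}"

lemma act_power_mono:
  assumes "act (p ^ n) x = 0" "n \<le> m"
  shows "act (p ^ m) x = 0"
proof -
  have "p ^ m = p ^ (m - n) * p ^ n" using assms(2) by (simp flip: power_add)
  then show ?thesis using assms(1) by (simp add: act_times)
qed

lemma component_subspace: "act.subspace (component p)"
proof (rule act.subspaceI)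
  show "0 \<in> component p" by (simp add: component_def)
  show "x + y \<in> component p" if "x \<in> component p" "y \<in> component p" for x y
  proof -
    from that obtain m n where "act (p ^ m) x = 0" "act (p ^ n) y = 0" by (auto simp: component_def)
    then have "act (p ^ max m n) (x + y) = 0"
      using act_power_mono[of p _ _ "max m n"] by (simp add: act_add_right)
    then show ?thesis by (auto simp: component_def)
  qed
  show "act r x \<in> component p" if "x \<in> component p" for r x
  proof -
    from that obtain m where "act (p ^ m) x = 0" by (auto simp: component_def)
    then have "act (p ^ m) (act r x) = 0" by (metis act.scale_left_commute act.scale_zero_right)
    then show ?thesis by (auto simp: component_def)
  qed
qed

lemma component_add: "x \<in> component p \<Longrightarrow> y \<in> component p \<Longrightarrow> x + y \<in> component p"
  using component_subspace by (rule act.subspace_add)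

lemma component_scale: "x \<in> component p \<Longrightarrow> scale a x \<in> component p"
  using act.subspace_scale[OF component_subspace, of x p "[:a:]"] by (simp add: act_const)

lemma component_u: "x \<in> component p \<Longrightarrow> u x \<in> component p"
  using act.subspace_scale[OF component_subspace, of x p "[:0, 1:]"] by simp

lemma component_primary:
  assumes "irreducible p"
  shows "primary_module act p (component p)"
  by unfold_locales
    (use component_subspace irreducible_poly_bezout[OF assms] in \<open>auto simp: component_def\<close>)

lemma coprime_kill:
  assumes "irreducible p" "\<not> p dvd r" "x \<in> component p" "act r x = 0"
  shows "x = 0"
proof -
  interpret primary_module act p "component p" by (rule component_primary) fact
  obtain s where "act s (act r x) = x" using inverse_on[OF assms(2,3)] by blast
  then show ?thesis using assms(4) by simp
qed

text \<open>From \<open>s * r = 1 + k * p ^ n\<close> follows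
  \<open>x = act (s * r) x - act (k * p ^ n) x\<close>; here \<open>p ^ n\<close> kills the first
  term and \<open>r\<close> the second.\<close>

lemma coprime_split:
  assumes "irreducible p" "\<not> p dvd r" "act (p ^ n * r) x = 0"
  shows "\<exists>y z. x = y + z \<and> act (p ^ n) y = 0 \<and> act r z = 0"
proof -
  obtain s k where sk: "s * r = 1 + k * p ^ n"
    using irreducible_poly_bezout[OF assms(1,2)] bezout_power by blast
  have x: "act (s * r) x = x + act (k * p ^ n) x" by (simp only: sk act_plus act_1)
  have "p ^ n * (s * r) = s * (p ^ n * r)" "r * (k * p ^ n) = k * (p ^ n * r)" by (simp_all only: mult_ac)
  then have "act (p ^ n) (act (s * r) x) = 0" "act r (act (k * p ^ n) x) = 0"
    using assms(3) by (metis act_times act.scale_zero_right)+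
  moreover have "x = act (s * r) x + act (- (k * p ^ n)) x" unfolding x by (simp flip: act_plus add: add.assoc)
  ultimately show ?thesis by (intro exI[of _ "act (s * r) x"] exI[of _ "act (- (k * p ^ n)) x"]) simp
qed

end

text \<open>The elements killed by some polynomial prime to \<open>p\<close> form a complement
  \<open>T\<close> of the component. Projecting a countable spanning set along \<open>T\<close>
  yields generators.\<close>

lemma (in operator) component_countably_generated:
  assumes p: "irreducible p" and B: "countable B" "span B = UNIV"
    and tors: "\<And>x. \<exists>q. q \<noteq> 0 \<and> act q x = 0"
  shows "\<exists>C. countable C \<and> C \<subseteq> component p \<and> component p \<subseteq> act.span C"
proof -
  define T where "T = {z. \<exists>r. \<not> p dvd r \<and> act r z = 0}"
  have "degree p \<noteq> 0" using p by (metis is_unit_iff_degree irreducible_def)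
  have "\<exists>y. y \<in> component p \<and> x - y \<in> T" for x
  proof -
    obtain q where q: "q \<noteq> 0" "act q x = 0" using tors by blast
    obtain n r where "q = p ^ n * r" "\<not> p dvd r"
      using poly_power_factor[of p q] \<open>degree p \<noteq> 0\<close> q(1) by blast
    then obtain y z where "x = y + z" "act (p ^ n) y = 0" "act r z = 0"
      using coprime_split[OF p] q(2) by blast
    then show ?thesis using \<open>\<not> p dvd r\<close> by (intro exI[of _ y]) (auto simp: component_def T_def)
  qed
  then obtain f where f: "\<And>x. f x \<in> component p" "\<And>x. x - f x \<in> T" by metis
  have T_add: "y + z \<in> T" if "y \<in> T" "z \<in> T" for y z
  proof -
    from that obtain r s where rs: "\<not> p dvd r" "act r y = 0" "\<not> p dvd s" "act s z = 0" by (auto simp: T_def)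
    have "act (r * s) y = act s (act r y)" "act (r * s) z = act r (act s z)"
      by (simp_all only: act_times mult.commute flip: act_times)
    then have "act (r * s) (y + z) = 0" using rs by (simp add: act_add_right)
    then show ?thesis using irreducible_poly_not_dvd_mult[OF p rs(1,3)] by (auto simp: T_def)
  qed
  have T_scale: "scale a z \<in> T" if "z \<in> T" for a z
    using that by (auto simp: T_def act_scale)
  have T0: "0 \<in> T" using p by (auto simp: T_def irreducible_def intro!: exI[of _ 1])
  define C where "C = f ` B"
  have CM: "act.span C \<subseteq> component p"
    using f(1) component_subspace by (intro act.span_minimal) (auto simp: C_def)
  have split: "\<exists>y\<in>act.span C. x - y \<in> T" if "x \<in> span B" for x
    using that
  proof (induction rule: span_induct_alt)
    case base
    then show ?case using T0 act.span_zero by force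
  next
    case (step c b x)
    then obtain y where y: "y \<in> act.span C" "x - y \<in> T" by blast
    have "scale c (f b) \<in> act.span C"
      using act.span_scale[of "f b" C "[:c:]"] step(1) by (auto simp: C_def act_const intro: act.span_base)
    then have "scale c (f b) + y \<in> act.span C" using y(1) by (rule act.span_add)
    moreover have "scale c b + x - (scale c (f b) + y) \<in> T"
      using T_add[OF T_scale[OF f(2), of c b] y(2)] by (simp add: scale_right_diff_distrib algebra_simps)
    ultimately show ?case by blast
  qed
  have "x \<in> act.span C" if x: "x \<in> component p" for x
  proof -
    obtain y where y: "y \<in> act.span C" "x - y \<in> T" using split B(2) by blast
    then have "x - y \<in> component p" using x CM act.subspace_diff[OF component_subspace] by blast
    moreover obtain r where "\<not> p dvd r" "act r (x - y) = 0" using y(2) by (auto simp: T_def)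
    ultimately have "x - y = 0" using coprime_kill[OF p] by blast
    then show ?thesis using y(1) by simp
  qed
  then show ?thesis using B(1) f(1) by (intro exI[of _ C]) (auto simp: C_def)
qed

section \<open>Invertible operators and the maps that reverse them\<close>

locale automorphism = operator scale u
  for scale :: "'f::field \<Rightarrow> 'v::ab_group_add \<Rightarrow> 'v" and u +
  fixes w :: "'v \<Rightarrow> 'v"
  assumes u_w [simp]: "u (w x) = x" and w_u [simp]: "w (u x) = x"
begin

lemma w_add: "w (x + y) = w x + w y"
  by (metis u_add u_w w_u)

lemma w_scale: "w (scale a x) = scale a (w x)"
  by (metis u_scale u_w w_u)

sublocale inverse: operator scale w
  by unfold_locales (simp_all add: w_add w_scale)

lemma funpow_u_add: "(u ^^ n) (x + y) = (u ^^ n) x + (u ^^ n) y"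
  by (induction n) (simp_all add: u_add)

lemma funpow_u_scale: "(u ^^ n) (scale a x) = scale a ((u ^^ n) x)"
  by (induction n) (simp_all add: u_scale)

lemma funpow_u_eq_0 [simp]: "(u ^^ n) x = 0 \<longleftrightarrow> x = 0"
proof (induction n)
  case (Suc n)
  have "u y = 0 \<longleftrightarrow> y = 0" for y by (metis u_zero w_u)
  then show ?case using Suc by simp
qed simp

lemma act_funpow: "act q ((u ^^ n) x) = (u ^^ n) (act q x)"
  by (induction n) (simp_all add: act_u)

text \<open>The reflected polynomial is \<open>t ^ d * q (1/t)\<close> with
  \<open>d = degree q\<close>; this identity is evaluated at \<open>u\<close>.\<close>

lemma act_reflect: "(u ^^ degree q) (inverse.act q x) = act (reflect_poly q) x"
proof (induction q)
  case 0
  then show ?case by simp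
next
  case (pCons a q)
  show ?case
  proof (cases "q = 0")
    case True
    then show ?thesis by simp
  next
    case False
    have "(u ^^ degree (pCons a q)) (inverse.act (pCons a q) x) =
        scale a ((u ^^ Suc (degree q)) x) + (u ^^ degree q) (inverse.act q x)"
      using False
      by (simp add: funpow_u_add funpow_u_scale u_scale funpow_swap1 del: funpow.simps(2))
         (simp add: u_scale funpow_swap1)
    then show ?thesis using False pCons.IH
      by (simp add: reflect_poly_pCons' act_plus act_monom)
  qed
qed

lemma inverse_act_eq_0: "inverse.act q x = 0 \<longleftrightarrow> act (reflect_poly q) x = 0"
  by (simp flip: act_reflect)

text \<open>The values of \<open>\<sigma>\<close> may leave \<open>M\<close>, since the component of
  \<open>p\<close> goes to that of the reciprocal polynomial.\<close>

definition twisted :: "('v \<Rightarrow> 'v) \<Rightarrow> 'v set \<Rightarrow> bool" where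
  "twisted \<sigma> M \<longleftrightarrow> (\<forall>x\<in>M. \<forall>y\<in>M. \<sigma> (x + y) = \<sigma> x + \<sigma> y) \<and>
     (\<forall>x\<in>M. \<forall>a. \<sigma> (scale a x) = scale a (\<sigma> x)) \<and> (\<forall>x\<in>M. \<sigma> (u x) = w (\<sigma> x))"

lemma twistedD:
  assumes "twisted \<sigma> M" "x \<in> M"
  shows "y \<in> M \<Longrightarrow> \<sigma> (x + y) = \<sigma> x + \<sigma> y" "\<sigma> (scale a x) = scale a (\<sigma> x)" "\<sigma> (u x) = w (\<sigma> x)"
  using assms by (auto simp: twisted_def)

lemma twisted_act:
  assumes "twisted \<sigma> (component p)" "x \<in> component p"
  shows "\<sigma> (act q x) = inverse.act q (\<sigma> x)"
  using intertwine[OF inverse.operator_axioms component_add component_scale component_u, of p \<sigma> x q]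
    assms twistedD by blast

text \<open>\<open>\<sigma>\<close> turns \<open>p ^ n\<close> evaluated at \<open>u\<close> into
  \<open>p ^ n\<close> evaluated at \<open>w\<close>, which by \<open>act_reflect\<close> is a power
  of the reciprocal polynomial at \<open>u\<close> up to an invertible factor.\<close>

lemma twisted_component:
  assumes p: "p \<in> monic_primes" and \<sigma>: "twisted \<sigma> (component p)" and x: "x \<in> component p"
  shows "\<sigma> x \<in> component (reciprocal_poly p)"
proof -
  define c where "c = coeff p 0"
  have c: "c \<noteq> 0" using p by (simp add: c_def monic_primes_def)
  then have refl: "reflect_poly p = smult c (reciprocal_poly p)" by (simp add: reciprocal_poly_def c_def)
  obtain n where n: "act (p ^ n) x = 0" using x by (auto simp: component_def)
  have "inverse.act (p ^ n) (\<sigma> x) = \<sigma> (act (p ^ n) x)" using twisted_act[OF \<sigma> x] by simp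
  also have "\<dots> = 0" using twistedD(2)[OF \<sigma> x, of 0] n by simp
  finally have "scale (c ^ n) (act (reciprocal_poly p ^ n) (\<sigma> x)) = 0"
    by (simp add: inverse_act_eq_0 reflect_poly_power refl smult_power act_smult)
  then show ?thesis using c by (auto simp: component_def)
qed

text \<open>Put \<open>d = degree p\<close> and \<open>c = coeff p 0\<close>. As \<open>u\<^sup>d p (w) = c p (u)\<close> and \<open>c\<^sup>2 = 1\<close>, mapping each
  tree basis element \<open>x\<close> with annihilator \<open>p\<^sup>n\<close> to \<open>c\<^sup>n u\<^sup>d\<^sup>n x\<close> respects the relations of the tree.\<close>

lemma self_reciprocal_involution:
  assumes p: "p \<in> monic_primes" "reciprocal_poly p = p"
    and C: "countable C" "C \<subseteq> component p" "component p \<subseteq> act.span C"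
  shows "\<exists>\<sigma>. twisted \<sigma> (component p) \<and> (\<forall>x\<in>component p. \<sigma> (\<sigma> x) = x)"
proof -
  have irr: "irreducible p" using p by (simp add: monic_primes_def)
  interpret primary_module act p "component p" by (rule component_primary[OF irr])
  obtain X where X: "act.tree_basis p X" "act.span X = component p"
    using tree_basis_exists[OF C] by blast
  note X_def = X(1)[unfolded act.tree_basis_def]
  define c where "c = coeff p 0"
  define d where "d = degree p"
  have c0: "c \<noteq> 0" using p by (simp add: c_def monic_primes_def)
  have refl: "reflect_poly p = smult c p"
  proof -
    have "smult c (reciprocal_poly p) = reflect_poly p" using c0 by (simp add: reciprocal_poly_def c_def)
    then show ?thesis using p(2) by simp
  qed
  \<comment> \<open>The constant coefficient of the reflected polynomial is the leading coefficient
    1 of \<open>p\<close>.\<close>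
  have "coeff (reflect_poly p) 0 = c * c" unfolding refl by (simp add: c_def)
  then have cc: "c * c = 1" using p by (simp add: monic_primes_def)
  have tw: "(u ^^ d) (inverse.act p x) = scale c (act p x)" for x
    using act_reflect[of p x] by (simp add: refl act_smult d_def)
  define e where "e x = (LEAST n. act (p ^ n) x = 0)" for x
  have e_le: "e x \<le> n" if "act (p ^ n) x = 0" for x n
    unfolding e_def using that by (rule Least_le)
  have e_kill: "act (p ^ e x) x = 0" if x: "x \<in> component p" for x
  proof -
    obtain m where "act (p ^ m) x = 0" using x by (auto simp: component_def)
    then show ?thesis unfolding e_def by (rule LeastI)
  qed
  define m where "m x = monom (c ^ e x) (d * e x)" for x
  define g where "g x = act (m x) x" for x
  have g: "g x = scale (c ^ e x) ((u ^^ (d * e x)) x)" for x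
    by (simp add: g_def m_def act_monom)
  have g0: "g 0 = 0" by (simp add: g_def)
  have g_p: "inverse.act p (g x) = g (act p x)" if x: "x \<in> component p" for x
  proof (cases "x = 0")
    case True
    then show ?thesis by (simp add: g0)
  next
    case False
    have px: "act p x \<in> component p" using x component_subspace by (simp add: act.subspace_scale)
    have "e x = Suc (e (act p x))"
    proof -
      have "e x \<noteq> 0" using e_kill[OF x] False by (metis act_1 power_0)
      then obtain k where k: "e x = Suc k" using not0_implies_Suc by blast
      have "act (p ^ k) (act p x) = act (p ^ e x) x" by (simp add: k mult.commute flip: act_times)
      then have "e (act p x) \<le> k" using e_le e_kill[OF x] by simp
      moreover have "act (p ^ Suc (e (act p x))) x = act (p ^ e (act p x)) (act p x)"
        by (simp add: mult.commute flip: act_times)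
      then have "e x \<le> Suc (e (act p x))" using e_le e_kill[OF px] by simp
      ultimately show ?thesis using k by simp
    qed
    then obtain k where k: "e (act p x) = k" "e x = Suc k" by blast
    have "(u ^^ d) (inverse.act p (g x)) = scale c (scale (c ^ Suc k) (act p ((u ^^ (d * Suc k)) x)))"
      by (simp only: tw g k act_scale)
    also have "act p ((u ^^ (d * Suc k)) x) = (u ^^ (d * Suc k)) (act p x)"
      by (rule act_funpow)
    also have "c * c ^ Suc k = c ^ k" using cc by (simp flip: mult.assoc)
    then have "scale c (scale (c ^ Suc k) ((u ^^ (d * Suc k)) (act p x))) =
        scale (c ^ k) ((u ^^ (d * Suc k)) (act p x))" by (simp only: scale_scale)
    also have "\<dots> = (u ^^ d) (g (act p x))" by (simp add: g k funpow_u_scale funpow_add)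
    finally have "(u ^^ d) (inverse.act p (g x) - g (act p x)) = 0"
      using funpow_u_add[of d "inverse.act p (g x) - g (act p x)" "g (act p x)"] by simp
    then show ?thesis by simp
  qed
  have XM: "X \<subseteq> component p" using X(2) act.span_superset by blast
  obtain f where f: "\<And>x. x \<in> X \<Longrightarrow> f x = g x"
    "\<And>a b. a \<in> component p \<Longrightarrow> b \<in> component p \<Longrightarrow> f (a + b) = f a + f b"
    "\<And>r a. a \<in> component p \<Longrightarrow> f (act r a) = inverse.act r (f a)"
    using tree_basis_extend[OF act.module_axioms inverse.act.module_axioms X(1), of g] g_p XM g0
    unfolding X(2) by blast
  have tw: "twisted f (component p)" unfolding twisted_def
  proof (intro conjI ballI allI)
    fix x assume x: "x \<in> component p"
    show "f (scale a x) = scale a (f x)" for a using f(3)[OF x, of "[:a:]"] by simp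
    show "f (u x) = w (f x)" using f(3)[OF x, of "[:0, 1:]"] by simp
  qed (use f(2) in auto)
  have mem: "f x \<in> component p" if "x \<in> component p" for x
    using twisted_component[OF p(1) tw that] p(2) by simp
  have fw: "f (w y) = u (f y)" if y: "y \<in> component p" for y
  proof -
    obtain n where "act (p ^ n) y = 0" using y by (auto simp: component_def)
    then have "u (act (p ^ n) (w y)) = 0" by (simp flip: act_u)
    then have "act (p ^ n) (w y) = 0" by (metis w_u inverse.u_zero)
    then have "w y \<in> component p" by (auto simp: component_def)
    then show ?thesis using twistedD(3)[OF tw, of "w y"] by (metis u_w)
  qed
  \<comment> \<open>\<open>f\<close> exchanges \<open>u\<close> and \<open>w\<close>, so its square
    commutes with the polynomial action and has to be compared with the identity on \<open>X\<close>
    only.\<close>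
  have ff_act: "f (f (act q x)) = act q (f (f x))" if x: "x \<in> component p" for q x
    using intertwine[OF operator_axioms component_add component_scale component_u, of p "\<lambda>x. f (f x)" x q]
      x f(2) mem twistedD[OF tw] fw by (simp add: component_u)
  have "x \<in> component p \<and> f (f x) = x" if "x \<in> act.span X" for x
    using that
  proof (induction rule: act.span_induct_alt)
    case base
    have "f 0 = 0" using twistedD(2)[OF tw act.subspace_0[OF component_subspace], of 0] by simp
    then show ?case using act.subspace_0[OF component_subspace] by simp
  next
    case (step r x y)
    have x: "x \<in> component p" and y: "y \<in> component p" using step XM by auto
    \<comment> \<open>\<open>m x\<close> acts as a scalar times a power of \<open>u\<close>;
      \<open>f\<close> turns it into the same scalar times that power of \<open>w\<close>, and the
      two cancel because \<open>c * c = 1\<close>.\<close>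
    have gx: "f x = act (m x) x" using f(1)[OF step(1)] by (simp add: g_def)
    have "f (f x) = inverse.act (m x) (f x)" unfolding gx using f(3)[OF x] gx by simp
    also have "\<dots> = x"
    proof -
      have "(w ^^ n) ((u ^^ n) y) = y" for n y
        by (induction n arbitrary: y) (simp_all add: funpow_swap1)
      moreover have "c ^ n * c ^ n = 1" for n using cc by (simp flip: power_mult_distrib)
      moreover have "(w ^^ n) (scale a y) = scale a ((w ^^ n) y)" for n a y
        by (induction n) (simp_all add: w_scale)
      ultimately show ?thesis unfolding gx m_def
        by (simp add: act_monom inverse.act_monom)
    qed
    finally have "f (f (act r x)) = act r x" using ff_act[OF x] by simp
    moreover have "act r x \<in> component p" using x component_subspace by (simp add: act.subspace_scale)
    ultimately show ?case using f(2) mem y step(2) component_add by simp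
  qed
  then show ?thesis using tw X(2) by blast
qed

end

section \<open>Gluing the components\<close>

text \<open>A product of powers of the other primes kills all other summands but is injective on the
  component of \<open>p\<close>, as \<open>p\<close> does not divide it.\<close>

lemma (in operator) components_independent:
  assumes "finite F" "F \<subseteq> monic_primes" "\<And>p. p \<in> F \<Longrightarrow> y p \<in> component p" "(\<Sum>p\<in>F. y p) = 0"
  shows "\<forall>p\<in>F. y p = 0"
  using assms
proof (induction F rule: finite_induct)
  case empty
  then show ?case by simp
next
  case (insert p F)
  have irr: "irreducible p" using insert.prems by (simp add: monic_primes_def)
  have "\<forall>q\<in>F. \<exists>n. act (q ^ n) (y q) = 0" using insert.prems(2) by (auto simp: component_def)
  then obtain n where n: "\<And>q. q \<in> F \<Longrightarrow> act (q ^ n q) (y q) = 0" by metis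
  define Q where "Q = (\<Prod>q\<in>F. q ^ n q)"
  have "act Q (y q) = 0" if "q \<in> F" for q
  proof -
    have "Q = (\<Prod>q\<in>F - {q}. q ^ n q) * q ^ n q"
      unfolding Q_def using prod.remove[OF insert.hyps(1) that, of "\<lambda>q. q ^ n q"] by (simp add: mult.commute)
    then show ?thesis using n[OF that] by (simp add: act_times)
  qed
  then have "act Q (\<Sum>q\<in>F. y q) = 0" by (simp add: act.scale_sum_right)
  moreover have yp: "y p = - (\<Sum>q\<in>F. y q)" using insert by (simp add: eq_neg_iff_add_eq_0)
  ultimately have "act Q (y p) = 0" by simp
  moreover have "\<not> p dvd Q"
    unfolding Q_def
  proof (intro irreducible_poly_not_dvd_prod irreducible_poly_not_dvd_power irr insert.hyps(1))
    show "\<not> p dvd q" if "q \<in> F" for q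
      using monic_irreducible_dvd_eq[of p q] that insert.hyps(2) insert.prems(1)
      by (auto simp: monic_primes_def)
  qed
  ultimately have "y p = 0" using coprime_kill[OF irr] insert.prems(2) by blast
  then show ?case using insert yp by simp
qed

text \<open>Factors equal to the indeterminate can be cancelled because \<open>u\<close> is
  injective.\<close>

lemma (in operator) monic_primes_torsion:
  assumes inj: "\<And>x. u x = 0 \<Longrightarrow> x = 0" and "q \<noteq> 0" "act q x = 0"
  shows "\<exists>q. coeff q 0 \<noteq> 0 \<and> act q x = 0"
  using assms(2,3)
proof (induction q)
  case (pCons a q)
  show ?case
  proof (cases "a = 0")
    case True
    then show ?thesis using pCons inj by auto
  next
    case False
    then show ?thesis using pCons.prems by (intro exI[of _ "pCons a q"]) simp
  qed
qed simp

text \<open>\<open>coprime_split\<close> splits off one prime power of \<open>q\<close> at a time.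
  The set \<open>W\<close> is arbitrary so that it can be the domain of the relation
  \<open>glue\<close>.\<close>

lemma (in operator) components_span:
  assumes W: "0 \<in> W" "\<And>p x y. p \<in> monic_primes \<Longrightarrow> x \<in> component p \<Longrightarrow> y \<in> W \<Longrightarrow> x + y \<in> W"
    and "coeff q 0 \<noteq> 0" "act q x = 0"
  shows "x \<in> W"
  using assms(3,4)
proof (induction "degree q" arbitrary: q x rule: less_induct)
  case less
  show ?case
  proof (cases "degree q = 0")
    case True
    then obtain c where "q = [:c:]" by (rule degree_eq_zeroE)
    then show ?thesis using less.prems W(1) by simp
  next
    case False
    then obtain p where p: "irreducible p" "lead_coeff p = 1" "p dvd q"
      using monic_irreducible_factor by blast
    have q0: "q \<noteq> 0" using False by auto
    have degp: "degree p > 0" using p(1) by (metis gr0I is_unit_iff_degree irreducible_def)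
    obtain n r where nr: "q = p ^ n * r" "\<not> p dvd r" using poly_power_factor[OF degp q0] by blast
    have "n \<noteq> 0"
    proof
      assume "n = 0"
      then show False using nr p(3) by simp
    qed
    have "coeff p 0 \<noteq> 0" using p(3) less.prems(1) by (auto simp: dvd_def coeff_mult_0)
    then have pP: "p \<in> monic_primes" using p by (simp add: monic_primes_def)
    have "degree r < degree q"
      using nr(1) q0 degp \<open>n \<noteq> 0\<close> by (auto simp: degree_mult_eq degree_power_eq)
    moreover have "coeff r 0 \<noteq> 0" using less.prems(1) nr(1) by (auto simp: coeff_mult_0)
    moreover obtain y z where yz: "x = y + z" "act (p ^ n) y = 0" "act r z = 0"
      using coprime_split[OF p(1) nr(2)] less.prems(2) nr(1) by blast
    ultimately have "z \<in> W" using less.hyps by blast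
    then show ?thesis unfolding yz(1) using W(2)[OF pP] yz(2) by (auto simp: component_def)
  qed
qed

context automorphism
begin

text \<open>The graph of the endomorphism that agrees with \<open>sg p\<close> on the \<open>p\<close>-component for all \<open>p\<close>.\<close>

inductive glue :: "('f poly \<Rightarrow> 'v \<Rightarrow> 'v) \<Rightarrow> 'v \<Rightarrow> 'v \<Rightarrow> bool" for sg where
  zero: "glue sg 0 0"
| add: "p \<in> monic_primes \<Longrightarrow> v \<in> component p \<Longrightarrow> glue sg x z \<Longrightarrow> glue sg (v + x) (sg p v + z)"

lemma glue_plus:
  assumes "glue sg x z" "glue sg x' z'"
  shows "glue sg (x + x') (z + z')"
  using assms
proof (induction rule: glue.induct)
  case (add p v x z)
  then have "glue sg (v + (x + x')) (sg p v + (z + z'))" by (intro glue.add) auto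
  then show ?case by (simp add: add.assoc)
qed simp

text \<open>Derivation steps with the same \<open>p\<close> are merged by additivity of
  \<open>sg p\<close>, so that \<open>components_independent\<close> can be applied to the
  summands.\<close>

lemma glue_representation:
  assumes "glue sg x z" and sg: "\<forall>p\<in>monic_primes. twisted (sg p) (component p)"
  shows "\<exists>F y. finite F \<and> F \<subseteq> monic_primes \<and> (\<forall>p\<in>F. y p \<in> component p) \<and>
    x = (\<Sum>p\<in>F. y p) \<and> z = (\<Sum>p\<in>F. sg p (y p))"
  using assms(1)
proof (induction rule: glue.induct)
  case zero
  show ?case by (intro exI[of _ "{}"]) simp
next
  case (add p v x z)
  then obtain F y where F: "finite F" "F \<subseteq> monic_primes" "\<forall>p\<in>F. y p \<in> component p"
    "x = (\<Sum>p\<in>F. y p)" "z = (\<Sum>p\<in>F. sg p (y p))" by auto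
  define y' where "y' = y(p := (if p \<in> F then v + y p else v))"
  have y'p: "y' p = (if p \<in> F then v + y p else v)" by (simp add: y'_def)
  have y'F: "(\<Sum>q\<in>F - {p}. y' q) = (\<Sum>q\<in>F - {p}. y q)"
    "(\<Sum>q\<in>F - {p}. sg q (y' q)) = (\<Sum>q\<in>F - {p}. sg q (y q))"
    by (auto simp: y'_def intro: sum.cong)
  have "v + x = (\<Sum>p\<in>insert p F. y' p) \<and> sg p v + z = (\<Sum>p\<in>insert p F. sg p (y' p))"
  proof (cases "p \<in> F")
    case True
    then have "sg p (v + y p) = sg p v + sg p (y p)" using twistedD(1)[OF bspec[OF sg]] add.hyps F(3) by blast
    then show ?thesis
      using True y'F y'p sum.remove[OF F(1) True, of y] sum.remove[OF F(1) True, of "\<lambda>p. sg p (y p)"]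
        sum.remove[OF F(1) True, of y'] sum.remove[OF F(1) True, of "\<lambda>p. sg p (y' p)"]
      by (simp add: F(4,5) insert_absorb add.assoc)
  next
    case False
    then show ?thesis using y'F F(1) by (simp add: F(4,5) y'_def)
  qed
  moreover have "\<forall>q\<in>insert p F. y' q \<in> component q" using F(3) add.hyps component_add by (auto simp: y'_def)
  ultimately show ?case using F(1,2) add.hyps(1) by (intro exI[of _ "insert p F"] exI[of _ y']) auto
qed

text \<open>The relation \<open>glue sg\<close> is single-valued by
  \<open>components_independent\<close>, total by \<open>components_span\<close>, and symmetric
  because the maps for \<open>p\<close> and its reciprocal undo each other; symmetry makes the
  resulting map an involution.\<close>

lemma glue_function:
  assumes sg: "\<And>p. p \<in> monic_primes \<Longrightarrow> twisted (sg p) (component p)"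
    and sg2: "\<And>p x. p \<in> monic_primes \<Longrightarrow> x \<in> component p \<Longrightarrow> sg (reciprocal_poly p) (sg p x) = x"
    and tors: "\<And>x. \<exists>q. q \<noteq> 0 \<and> act q x = 0"
  shows "\<exists>\<sigma>. twisted \<sigma> UNIV \<and> (\<forall>x. \<sigma> (\<sigma> x) = x)"
proof -
  have scale: "glue sg (scale a x) (scale a z)" if "glue sg x z" for a x z
    using that
  proof (induction rule: glue.induct)
    case (add p v x z)
    then have "glue sg (scale a v + scale a x) (sg p (scale a v) + scale a z)"
      by (intro glue.add component_scale)
    then show ?case using twistedD(2)[OF sg] add.hyps by (simp add: scale_right_distrib)
  qed (simp add: glue.zero)
  have commute: "glue sg (u x) (w z)" if "glue sg x z" for x z
    using that
  proof (induction rule: glue.induct)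
    case (add p v x z)
    then have "glue sg (u v + u x) (sg p (u v) + w z)" by (intro glue.add component_u)
    then show ?case using twistedD(3)[OF sg] add.hyps by (simp add: u_add w_add)
  qed (simp add: glue.zero)
  have swap: "glue sg z x" if "glue sg x z" for x z
    using that
  proof (induction rule: glue.induct)
    case (add p v x z)
    have "glue sg (sg p v + z) (sg (reciprocal_poly p) (sg p v) + x)"
      using add twisted_component[OF _ sg] by (intro glue.add reciprocal_monic_prime)
    then show ?case using sg2 add.hyps by simp
  qed (simp add: glue.zero)
  have sg': "\<forall>p\<in>monic_primes. twisted (sg p) (component p)" using sg by blast
  have zero: "z = 0" if z: "glue sg 0 z" for z
  proof -
    obtain F y where F: "finite F" "F \<subseteq> monic_primes" "\<forall>p\<in>F. y p \<in> component p"
      "0 = (\<Sum>p\<in>F. y p)" "z = (\<Sum>p\<in>F. sg p (y p))"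
      using glue_representation[OF z sg'] by (elim exE conjE) (rule that)
    then have "\<forall>p\<in>F. y p = 0" using components_independent[of F y] F(4)[symmetric] by blast
    moreover have "sg p 0 = 0" if "p \<in> F" for p
      using twistedD(2)[OF sg act.subspace_0[OF component_subspace], of p 0] that F(2) by auto
    ultimately show ?thesis using F(5) by simp
  qed
  have unique: "z = z'" if "glue sg x z" "glue sg x z'" for x z z'
  proof -
    have "glue sg (x + scale (- 1) x) (z + scale (- 1) z')" using that by (intro glue_plus scale)
    then show ?thesis using zero[of "z - z'"] by simp
  qed
  have total: "\<exists>z. glue sg x z" for x
  proof -
    obtain q where "coeff q 0 \<noteq> 0" "act q x = 0"
      using tors monic_primes_torsion[of _ x] by (metis w_u inverse.u_zero)
    then have "x \<in> {x. \<exists>z. glue sg x z}"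
      by (rule components_span[rotated 2]) (auto intro: glue.intros)
    then show ?thesis by blast
  qed
  define \<sigma> where "\<sigma> x = (THE z. glue sg x z)" for x
  have \<sigma>: "\<sigma> x = z" if "glue sg x z" for x z
    unfolding \<sigma>_def by (rule the_equality) (use that unique in auto)
  have graph: "glue sg x (\<sigma> x)" for x using total \<sigma> by metis
  have "twisted \<sigma> UNIV"
    unfolding twisted_def using \<sigma>[OF glue_plus[OF graph graph]] \<sigma>[OF scale[OF graph]] \<sigma>[OF commute[OF graph]]
    by simp
  then show ?thesis using \<sigma>[OF swap[OF graph]] by blast
qed

theorem reversing_involution_exists:
  assumes B: "countable B" "span B = UNIV"
    and tors: "\<And>x. \<exists>q. q \<noteq> 0 \<and> act q x = 0"
    and phi: "twisted \<phi> UNIV" and psi: "\<And>x. \<phi> (\<psi> x) = x" "\<And>x. \<psi> (\<phi> x) = x"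
  shows "\<exists>\<sigma>. twisted \<sigma> UNIV \<and> (\<forall>x. \<sigma> (\<sigma> x) = x)"
proof -
  have psi': "twisted \<psi> UNIV"
    unfolding twisted_def
  proof (intro conjI ballI allI)
    fix x y a
    have "\<phi> (\<psi> x + \<psi> y) = x + y" using twistedD(1)[OF phi, of "\<psi> x" "\<psi> y"] psi(1) by simp
    then show "\<psi> (x + y) = \<psi> x + \<psi> y" by (metis psi(2))
    have "\<phi> (scale a (\<psi> x)) = scale a x" using twistedD(2)[OF phi, of "\<psi> x" a] psi(1) by simp
    then show "\<psi> (scale a x) = scale a (\<psi> x)" by (metis psi(2))
    \<comment> \<open>From \<open>\<phi> u = w \<phi>\<close> follows
      \<open>\<phi> w = u \<phi>\<close>, so that the inverse \<open>\<psi>\<close> reverses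
      \<open>u\<close> as well.\<close>
    have "x = w (\<phi> (w (\<psi> x)))" using twistedD(3)[OF phi, of "w (\<psi> x)"] psi(1) by simp
    then have "\<phi> (w (\<psi> x)) = u x" by (metis u_w)
    then show "\<psi> (u x) = w (\<psi> x)" by (metis psi(2))
  qed
  have "\<exists>\<sigma>. twisted \<sigma> (component p) \<and> (\<forall>x\<in>component p. \<sigma> (\<sigma> x) = x)"
    if p: "p \<in> monic_primes" "reciprocal_poly p = p" for p
  proof -
    have "irreducible p" using p(1) by (simp add: monic_primes_def)
    then obtain C where "countable C" "C \<subseteq> component p" "component p \<subseteq> act.span C"
      using component_countably_generated[OF _ B tors, of p] by auto
    then show ?thesis by (rule self_reciprocal_involution[OF p])
  qed
  then obtain S where S: "\<And>p. p \<in> monic_primes \<Longrightarrow> reciprocal_poly p = p \<Longrightarrow>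
      twisted (S p) (component p) \<and> (\<forall>x\<in>component p. S p (S p x) = x)" by metis
  \<comment> \<open>One member of each pair of reciprocal polynomials is selected; the predicate
    under \<open>SOME\<close> is the same for both, so both select the same one. The selected member
    uses \<open>\<phi>\<close>, the other \<open>\<psi>\<close>.\<close>
  define leader where "leader p = (SOME q. q = p \<or> q = reciprocal_poly p)" for p :: "'f poly"
  define sg where "sg p = (if reciprocal_poly p = p then S p else if leader p = p then \<phi> else \<psi>)" for p
  show ?thesis
  proof (rule glue_function[of sg, OF _ _ tors])
    show "twisted (sg p) (component p)" if "p \<in> monic_primes" for p
      using S[OF that] phi psi' by (auto simp: sg_def twisted_def)
    show "sg (reciprocal_poly p) (sg p x) = x" if p: "p \<in> monic_primes" and x: "x \<in> component p" for p x
    proof (cases "reciprocal_poly p = p")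
      case True
      then show ?thesis using S[OF p] x by (simp add: sg_def)
    next
      case False
      have "leader p = p \<or> leader p = reciprocal_poly p"
        unfolding leader_def by (rule someI[of _ p]) simp
      moreover have "leader (reciprocal_poly p) = leader p"
        unfolding leader_def reciprocal_reciprocal[OF p] by (simp add: disj_commute)
      ultimately show ?thesis using False psi by (auto simp: sg_def reciprocal_reciprocal[OF p])
    qed
  qed
qed

end

section \<open>Local finiteness and the two directions of the theorem\<close>

lemma (in operator) locally_finite_torsion:
  assumes "locally_finite scale u"
  shows "\<exists>q. q \<noteq> 0 \<and> act q x = 0"
proof -
  obtain I c where I: "finite I" "\<exists>i\<in>I. c i \<noteq> 0" "(\<Sum>i\<in>I. scale (c i) ((u ^^ i) x)) = 0"
    using assms[unfolded locally_finite_def, rule_format, of x] by (auto simp: dependent_family_def)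
  \<comment> \<open>The family is indexed by exponents, so different indices give different
    monomials, and a nonzero \<open>c i\<close> survives as a coefficient.\<close>
  define q where "q = (\<Sum>i\<in>I. monom (c i) i)"
  have "act q x = 0" unfolding q_def act.scale_sum_left using I(3) by (simp add: act_monom)
  moreover have "coeff q i = c i" if "i \<in> I" for i
    using I(1) that by (simp add: q_def coeff_sum if_distrib sum.delta cong: if_cong)
  then have "q \<noteq> 0" using I(2) by auto
  ultimately show ?thesis by blast
qed

theorem theorem1p5:
  fixes scale :: "'f::field \<Rightarrow> 'v::ab_group_add \<Rightarrow> 'v"
    and u :: "'v \<Rightarrow> 'v"
  assumes "vector_space scale"
    and "countable_dimension scale"
    and "u \<in> GL scale"
    and "locally_finite scale u"
  shows "(\<exists>a\<in>GL scale. \<exists>b\<in>GL scale.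
            involution scale a \<and> involution scale b \<and> u = a \<circ> b)
         \<longleftrightarrow> similar scale u (inv u)"
proof
  assume "\<exists>a\<in>GL scale. \<exists>b\<in>GL scale. involution scale a \<and> involution scale b \<and> u = a \<circ> b"
  then obtain a b where ab: "a \<in> GL scale" "a \<circ> a = id" "b \<circ> b = id" "u = a \<circ> b"
    by (auto simp: involution_def)
  have a: "a (a x) = x" and b: "b (b x) = x" for x using ab(2,3) by (auto simp: fun_eq_iff)
  \<comment> \<open>The similarity is \<open>a\<close> itself: \<open>a u a = b a\<close>, which is
    the inverse of \<open>u\<close>.\<close>
  have "inv a = a" by (rule inv_unique_comp) fact+
  moreover have "inv u = b \<circ> a" by (rule inv_unique_comp) (auto simp: ab(4) a b)
  ultimately have "inv u = a \<circ> u \<circ> inv a" by (auto simp: ab(4) a)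
  then show "similar scale u (inv u)" using ab(1) by (auto simp: similar_def)
next
  assume "similar scale u (inv u)"
  then obtain \<phi> where \<phi>: "\<phi> \<in> GL scale" "inv u = \<phi> \<circ> u \<circ> inv \<phi>" by (auto simp: similar_def)
  interpret vector_space scale by fact
  have u: "Vector_Spaces.linear scale scale u" "bij u" and \<phi>': "Vector_Spaces.linear scale scale \<phi>" "bij \<phi>"
    using assms(3) \<phi>(1) by (auto simp: GL_def endomorphism_def)
  interpret automorphism scale u "inv u"
    by unfold_locales
      (use u in \<open>auto simp: Vector_Spaces.linear_iff bij_is_inj bij_is_surj surj_f_inv_f\<close>)
  obtain B where B: "countable B" "span B = UNIV"
    using assms(2) by (auto simp: countable_dimension_def)
  have "twisted \<phi> UNIV" unfolding twisted_def
  proof (intro conjI ballI allI)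
    fix x
    have "inv u (\<phi> x) = \<phi> (u (inv \<phi> (\<phi> x)))" by (subst \<phi>(2)) simp
    then show "\<phi> (u x) = inv u (\<phi> x)" using \<phi>'(2) by (simp add: bij_is_inj)
  qed (use \<phi>'(1) in \<open>auto simp: Vector_Spaces.linear_iff\<close>)
  then obtain \<sigma> where \<sigma>: "twisted \<sigma> UNIV" and inv: "\<And>x. \<sigma> (\<sigma> x) = x"
    using reversing_involution_exists[OF B locally_finite_torsion[OF assms(4)], of \<phi> "inv \<phi>"] \<phi>'(2)
    by (auto simp: bij_is_inj bij_is_surj surj_f_inv_f)
  \<comment> \<open>As \<open>\<sigma>\<close> reverses \<open>u\<close>, the map
    \<open>\<sigma> u\<close> squares to the identity:
    \<open>\<sigma> u \<sigma> u = u^-1 \<sigma> \<sigma> u\<close>.\<close>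
  define b where "b = \<sigma> \<circ> u"
  have "Vector_Spaces.linear scale scale \<sigma>"
    using \<sigma> by (auto simp: twisted_def Vector_Spaces.linear_iff intro: vector_space_axioms)
  moreover from this have "Vector_Spaces.linear scale scale b"
    unfolding b_def by (rule Vector_Spaces.linear_compose[OF u(1)])
  moreover have "\<sigma> \<circ> \<sigma> = id" "b \<circ> b = id"
    using inv twistedD(3)[OF \<sigma>] by (auto simp: fun_eq_iff b_def)
  moreover have "u = \<sigma> \<circ> b" using inv by (auto simp: b_def)
  ultimately show "\<exists>a\<in>GL scale. \<exists>b\<in>GL scale. involution scale a \<and> involution scale b \<and> u = a \<circ> b"
    by (auto simp: GL_def endomorphism_def involution_def intro!: bexI[of _ \<sigma>] bexI[of _ b] o_bij)
qed

end
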